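(* For the sparse configuration model $\mathrm{CM}_n(\mathbf d)$ with triangle friendship-bias $\Delta^T_{[n]}$, and $m_k=m_k(n)=\sum_{i\in[n]}d_i^k$ for $k\in\mathbb N$, the following hold: (a) If $m_1>7$, then $$\mathbb E[\Delta^T_{[n]}]=\frac{1}{2(m_1-1)(m_1-3)(m_1-5)(m_1-7)}\left(\frac{A_1+A_2+A_3}{n}+(B_1+B_2+B_3)\right),$$ with $$A_1=6m_1m_3-18m_1m_4+14m_1m_5-2m_1m_6+4m_2m_3-8m_2m_4+4m_3^2,$$ $$A_2=-14m_1m_2m_3+3m_1m_2m_4-9m_1^2m_2+18m_1^2m_3-5m_1^2m_4+3m_1m_2^2+4m_2^3,$$ $$A_3=-7m_1^3m_2-m_1m_2^3+5m_1^2m_2^2+3m_1^4,$$ and $$B_1=2m_7-10m_6+14m_5-6m_4,$$ $$B_2=6m_1m_3-8m_1m_4+2m_1m_5-13m_2m_3+11m_2m_4-2m_2m_5-m_3m_4+3m_2^2+2m_3^2,$$ $$B_3=-2m_1m_2m_3-3m_1^2m_2+m_1^2m_3+6m_1m_2^2+m_2^2m_3-3m_2^3.$$ (b) Suppose that for every $1\le k\le7$ the limit $c_k=\lim_{n\to\infty}n^{-1}m_k(n)$ exists and is strictly positive and finite. Then $$\lim_{n\to\infty}\mathbb E[n\Delta^T_{[n]}]=\zeta(c_1,c_2,c_3)$$ with $$\zeta(c_1,c_2,c_3)=\frac{(c_2-c_1)^2}{2c_1^4}\big[(c_3-c_1c_2)-3(c_2-c_1^2)\big]\ge0.$$ Equality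 holds if and only if $c_2=c_1^2$, i.e., for the special case of the $d$-regular random graph with $c_k=d^k$, $k\in\mathbb N$. (c) Suppose that for every $1\le k\le7$ the limit $c_k=\lim_{n\to\infty}n^{-1}m_k(n)$ exists and is strictly positive and finite. Then, with the exception of the $d$-regular random graph, the weak law of large numbers fails for $n\Delta^T_{[n]}$ because $$\liminf_{n\to\infty}\mathbb P(n\Delta^T_{[n]}=0)>0.$$
   Context: Configuration model. For each $n$, let $\mathbf d=(d_i)_{i\in[n]}\in\mathbb N^n$ (so $d_i\ge1$; the sequence may depend on $n$) be a degree sequence with even sum $m_1=\sum_{i\in[n]}d_i$. $\mathrm{CM}_n(\mathbf d)$ is the random multigraph on $[n]=\{1,\dots,n\}$ obtained by attaching $d_i$ half-edges to vertex $i$ for each $i$ and pairing all $m_1$ half-edges by a uniformly random perfect matching, each matched pair forming an edge. Self-loops and multiple edges are allowed. $A_{ij}$ is the number of edges between $i$ and $j$ when $i\ne j$, and $A_{ii}$ is twice the number of self-loops at $i$; thus $d_i=\sum_jA_{ij}$. The $d$-regular random graph is the case $d_i=d$ for all $i$. Triangle friendship-bias for $\mathrm{CM}_n(\mathbf d)$ (convention). The number of triangles at $i$, counted with edge multiplicities, is $t_i=\frac12\sum_{j,k}A_{ij}A_{jk}A_{ki}$, the sum being over $j,k\in[n]$ with $i,j,k$ pairwise distinct. Then $$\Delta^T_{i,n}=\Big[\frac1{d_i}\sum_{j\in[n]}A_{ij}t_j-t_i\Big]\mathbf 1_{\{d_i\ne0\}},\qquad\Delta^T_{[n]}=\frac1n\sum_{i\in[n]}\Delta^T_{i,n},$$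 where the sum over $j$ includes $j=i$ (the term $A_{ii}t_i$). $\mathbb P,\mathbb E$ refer to the random pairing. "Weak law of large numbers" for $n\Delta^T_{[n]}$ refers to convergence in probability of $n\Delta^T_{[n]}$ to the limit $\zeta(c_1,c_2,c_3)$ of its mean.
   Formalization: Degrees in {1,2} refute (b),(c). Proved: in (b) equality iff c_2=c_1^2 or the share of vertices of degree >2 tends to 0; in (c) the weak law is said to fail only if that share does not tend to 0. "d-regular" is read as c_2=c_1^2, equivalent to c_k=d^k for k≤6. *)

theory Defs
  imports "HOL-Probability.Probability" "HOL-Library.Disjoint_Sets"
begin

definition degree_sequence :: "nat \<Rightarrow> (nat \<Rightarrow> nat) \<Rightarrow> bool" where
  "degree_sequence n d \<longleftrightarrow> (\<forall>i\<in>{1..n}. 1 \<le> d i) \<and> even (\<Sum>i\<in>{1..n}. d i)"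

definition deg_moment :: "nat \<Rightarrow> (nat \<Rightarrow> nat) \<Rightarrow> nat \<Rightarrow> real" where
  "deg_moment n d k = (\<Sum>i\<in>{1..n}. real (d i) ^ k)"

text \<open>The half-edges at vertex \<open>i\<close> are the pairs \<open>(i, a)\<close> with \<open>a < d i\<close>.\<close>

definition half_edges :: "nat \<Rightarrow> (nat \<Rightarrow> nat) \<Rightarrow> (nat \<times> nat) set" where
  "half_edges n d = (SIGMA i:{1..n}. {..<d i})"

definition pairings :: "nat \<Rightarrow> (nat \<Rightarrow> nat) \<Rightarrow> (nat \<times> nat) set set set" where
  "pairings n d = {M. partition_on (half_edges n d) M \<and> (\<forall>e\<in>M. card e = 2)}"

definition config_model :: "nat \<Rightarrow> (nat \<Rightarrow> nat) \<Rightarrow> (nat \<times> nat) set set pmf" where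
  "config_model n d = pmf_of_set (pairings n d)"

text \<open>\<open>fst ` e\<close> is the set of endpoints of the edge formed by the matched pair \<open>e\<close>, a singleton
  exactly when \<open>e\<close> is a self-loop; each self-loop contributes 2 to the diagonal entry.\<close>

definition adj :: "(nat \<times> nat) set set \<Rightarrow> nat \<Rightarrow> nat \<Rightarrow> nat" where
  "adj M i j = (if i = j then 2 else 1) * card {e\<in>M. fst ` e = {i, j}}"

definition triangles :: "nat \<Rightarrow> (nat \<times> nat) set set \<Rightarrow> nat \<Rightarrow> real" where
  "triangles n M i =
     (\<Sum>(j, k)\<in>{(j, k). j \<in> {1..n} \<and> k \<in> {1..n} \<and> i \<noteq> j \<and> j \<noteq> k \<and> k \<noteq> i}.
        real (adj M i j * adj M j k * adj M k i)) / 2"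

definition bias_at :: "nat \<Rightarrow> (nat \<Rightarrow> nat) \<Rightarrow> (nat \<times> nat) set set \<Rightarrow> nat \<Rightarrow> real" where
  "bias_at n d M i =
     (if d i \<noteq> 0
      then (\<Sum>j\<in>{1..n}. real (adj M i j) * triangles n M j) / real (d i) - triangles n M i
      else 0)"

definition bias :: "nat \<Rightarrow> (nat \<Rightarrow> nat) \<Rightarrow> (nat \<times> nat) set set \<Rightarrow> real" where
  "bias n d M = (\<Sum>i\<in>{1..n}. bias_at n d M i) / real n"

definition zeta :: "real \<Rightarrow> real \<Rightarrow> real \<Rightarrow> real" where
  "zeta c1 c2 c3 = (c2 - c1)^2 / (2 * c1^4) * ((c3 - c1 * c2) - 3 * (c2 - c1^2))"

text \<open>The \<open>X n\<close> may live on different probability spaces; the limit is a constant.\<close>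

definition tendsto_in_prob :: "(nat \<Rightarrow> 'a pmf) \<Rightarrow> (nat \<Rightarrow> 'a \<Rightarrow> real) \<Rightarrow> real \<Rightarrow> bool" where
  "tendsto_in_prob P X L \<longleftrightarrow>
     (\<forall>\<epsilon>>0. (\<lambda>n. measure_pmf.prob (P n) {\<omega>. \<bar>X n \<omega> - L\<bar> > \<epsilon>}) \<longlonglongrightarrow> 0)"

text \<open>The proportion of vertices of degree larger than two vanishes, i.e. the limiting degree
  distribution lives on \<open>{1, 2}\<close>. In this case \<open>zeta\<close> vanishes even if the limiting degree
  distribution is not a point mass: see the lemma \<open>zeta_zero_not_regular\<close>. If all degrees are at
  most two then every triangle is an isolated component, so the bias is identically zero.\<close>

definition degrees_mostly_le_2 :: "(nat \<Rightarrow> nat \<Rightarrow> nat) \<Rightarrow> bool" where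
  "degrees_mostly_le_2 d \<longleftrightarrow> (\<lambda>n. real (card {i\<in>{1..n}. d n i > 2}) / real n) \<longlonglongrightarrow> 0"

text \<open>Half of the vertices have degree one, the other half degree two (up to rounding).\<close>

lemma zeta_zero_not_regular:
  fixes d :: "nat \<Rightarrow> nat \<Rightarrow> nat" and c :: "nat \<Rightarrow> real"
  defines "d \<equiv> \<lambda>n i. if i \<le> 2 * (n div 4) then 1 else 2" and "c \<equiv> \<lambda>k. (1 + 2 ^ k) / 2"
  shows "degree_sequence n (d n)"
    and "c k > 0" and "(\<lambda>n. deg_moment n (d n) k / real n) \<longlonglongrightarrow> c k"
    and "zeta (c 1) (c 2) (c 3) = 0" and "c 2 \<noteq> (c 1)\<^sup>2"
proof -
  have split: "(\<Sum>i\<in>{1..n}. if i \<le> 2 * (n div 4) then a else b)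
      = of_nat (2 * (n div 4)) * a + of_nat (n - 2 * (n div 4)) * b"
    for n and a b :: "'a :: comm_semiring_1"
  proof -
    have "{1..n} \<inter> {i. i \<le> 2 * (n div 4)} = {1..2 * (n div 4)}"
      and "{1..n} \<inter> - {i. i \<le> 2 * (n div 4)} = {2 * (n div 4) + 1..n}" by auto
    then show ?thesis by (subst sum.If_cases) auto
  qed
  show "degree_sequence n (d n)"
    using split[of n "1::nat" 2] by (simp add: degree_sequence_def d_def)
  show "c k > 0" by (simp add: c_def add_pos_pos)
  have "(\<lambda>n. real (n div 4) / real n) \<longlonglongrightarrow> 1 / 4"
  proof (rule tendsto_sandwich)
    show "\<forall>\<^sub>F n in sequentially. 1 / 4 - 1 / real n \<le> real (n div 4) / real n"
    proof (intro eventually_sequentiallyI[of 1])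
      fix n :: nat assume "1 \<le> n"
      moreover have "real n \<le> 4 * real (n div 4) + 4" by linarith
      ultimately have "(real n / 4 - 1) / real n \<le> real (n div 4) / real n"
        by (intro divide_right_mono) auto
      then show "1 / 4 - 1 / real n \<le> real (n div 4) / real n"
        using \<open>1 \<le> n\<close> by (simp add: diff_divide_distrib)
    qed
    show "\<forall>\<^sub>F n in sequentially. real (n div 4) / real n \<le> 1 / 4"
    proof (intro eventually_sequentiallyI[of 1])
      fix n :: nat assume "1 \<le> n"
      moreover have "4 * real (n div 4) \<le> real n" by linarith
      ultimately show "real (n div 4) / real n \<le> 1 / 4" by (simp add: field_simps)
    qed
    have "(\<lambda>n. 1 / 4 - 1 / real n) \<longlonglongrightarrow> 1 / 4 - 0"
      by (intro tendsto_intros lim_1_over_n)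
    then show "(\<lambda>n. 1 / 4 - 1 / real n) \<longlonglongrightarrow> 1 / 4" by simp
  qed simp
  then have "(\<lambda>n. 2 * (real (n div 4) / real n) + (1 - 2 * (real (n div 4) / real n)) * 2 ^ k)
      \<longlonglongrightarrow> 2 * (1 / 4) + (1 - 2 * (1 / 4)) * 2 ^ k"
    by (intro tendsto_add tendsto_diff tendsto_mult tendsto_const)
  moreover have "\<forall>\<^sub>F n in sequentially.
      2 * (real (n div 4) / real n) + (1 - 2 * (real (n div 4) / real n)) * 2 ^ k
      = deg_moment n (d n) k / real n"
  proof (intro eventually_sequentiallyI[of 1])
    fix n :: nat assume n: "1 \<le> n"
    have "deg_moment n (d n) k = (\<Sum>i\<in>{1..n}. if i \<le> 2 * (n div 4) then 1 else 2 ^ k)"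
      unfolding deg_moment_def d_def by (intro sum.cong) auto
    also have "\<dots> = 2 * real (n div 4) + (real n - 2 * real (n div 4)) * 2 ^ k"
      by (subst split) (simp add: of_nat_diff)
    finally show "2 * (real (n div 4) / real n) + (1 - 2 * (real (n div 4) / real n)) * 2 ^ k
        = deg_moment n (d n) k / real n"
      using n by (simp add: field_simps)
  qed
  ultimately have "(\<lambda>n. deg_moment n (d n) k / real n) \<longlonglongrightarrow> 2 * (1 / 4) + (1 - 2 * (1 / 4)) * 2 ^ k"
    by (rule Lim_transform_eventually)
  then show "(\<lambda>n. deg_moment n (d n) k / real n) \<longlonglongrightarrow> c k"
    by (simp add: c_def add_divide_distrib)
  show "zeta (c 1) (c 2) (c 3) = 0" and "c 2 \<noteq> (c 1)\<^sup>2"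
    by (simp_all add: zeta_def c_def power2_eq_square)
qed

end

theory Submission
  imports Defs "HOL-Combinatorics.Transposition"
begin

text \<open>
  Write \<open>m\<close> for the number of half-edges. For a uniformly random pairing, \<open>k\<close> prescribed disjoint
  pairs occur together with probability \<open>1 / ((m - 1) (m - 3) \<dots> (m - 2 k + 1))\<close>
  (\<open>card_containing\<close>).

  \<^emph>\<open>The mean.\<close> Exchanging summations gives \<open>n \<Delta> = \<Sum>\<^sub>j t\<^sub>j (\<Sum>\<^sub>i A\<^sub>i\<^sub>j / d\<^sub>i - 1)\<close>. The inner sum runs over the
  half-edges at \<open>j\<close> and adds the inverse degree of the vertex of the partner. Condition on a triangle
  \<open>j, k, l\<close>. The two half-edges at \<open>j\<close> that belong to it contribute \<open>1 / d\<^sub>k + 1 / d\<^sub>l\<close>. Each of the other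
  \<open>d\<^sub>j - 2\<close> half-edges has a uniform partner among the \<open>m - 7\<close> remaining ones, and inverse degrees summed
  over all half-edges give \<open>n\<close>, so it contributes
  \<open>(n - 3 / d\<^sub>j - 2 / d\<^sub>k - 2 / d\<^sub>l) / (m - 7)\<close> (\<open>expectation_triangle_weight\<close>). After multiplication with
  the number of labelled triangles on \<open>j, k, l\<close>, everything is polynomial in the degrees, and summation
  over triples of distinct vertices by inclusion-exclusion yields the exact formula
  (\<open>expectation_bias_moments\<close>). Its terms of top order give the limit \<open>zeta\<close>.

  \<^emph>\<open>The sign of the limit.\<close> For independent copies \<open>D, D'\<close> of the limiting degree, the last factor of
  \<open>zeta\<close> is half the mean of \<open>(D - D')\<^sup>2 (D + D' - 3)\<close>, which is nonnegative because different positive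
  integers have sum at least three. It vanishes only if \<open>D\<close> is constant or supported on \<open>{1, 2}\<close>.
  The argument is carried out for the empirical distributions, with an explicit inequality for pairs
  and triples of degrees.

  \<^emph>\<open>Failure of the weak law.\<close> The bias vanishes if there is no triangle. Having no triangle means
  avoiding a family of sets of pairs, and such events satisfy a local lemma: by switching two partners,
  avoiding sets that are compatible with a set \<open>F\<close> of pairs does not make \<open>F\<close> more likely
  (\<open>card_containing_avoiding_le\<close>). A labelled triangle is incompatible with \<open>O (d\<^sub>m\<^sub>a\<^sub>x n\<^sup>2)\<close> others, each of
  probability \<open>O (n\<^sup>-\<^sup>3)\<close>, and \<open>d\<^sub>m\<^sub>a\<^sub>x = O (\<surd>n)\<close>, so the local lemma applies to large \<open>n\<close>. As the expected
  number of triangles is bounded, the probability of having none is bounded away from zero.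
  If \<open>zeta\<close> is positive, this excludes convergence in probability to it.
\<close>

section \<open>Uniform perfect matchings\<close>

definition perfect_matchings :: "'a set \<Rightarrow> 'a set set set" where
  "perfect_matchings H = {M. partition_on H M \<and> (\<forall>e\<in>M. card e = 2)}"

abbreviation avoiding :: "'a set set set \<Rightarrow> 'a set set \<Rightarrow> bool" where
  "avoiding S M \<equiv> \<forall>B\<in>S. \<not> B \<subseteq> M"

lemma finite_perfect_matchings:
  assumes "finite H" shows "finite (perfect_matchings H)"
proof (rule finite_subset)
  show "perfect_matchings H \<subseteq> Pow (Pow H)"
    by (auto simp: perfect_matchings_def partition_on_def)
qed (use assms in simp)

lemma perfect_matchings_edge_eq:
  assumes "M \<in> perfect_matchings H" "e \<in> M" "e' \<in> M" "x \<in> e" "x \<in> e'"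
  shows "e = e'"
  using assms by (auto simp: perfect_matchings_def partition_on_def dest: disjointD)

lemma perfect_matchings_edgeD:
  assumes "M \<in> perfect_matchings H" "e \<in> M"
  shows "card e = 2" "e \<subseteq> H"
  using assms by (auto simp: perfect_matchings_def partition_on_def)

lemma perfect_matchings_coverE:
  assumes "M \<in> perfect_matchings H" "u \<in> H"
  obtains w where "w \<in> H" "w \<noteq> u" "{u, w} \<in> M"
proof -
  obtain e where e: "e \<in> M" "u \<in> e"
    using assms by (auto simp: perfect_matchings_def partition_on_def)
  with perfect_matchings_edgeD[OF assms(1)] obtain x y where "e = {x, y}" "x \<noteq> y" "e \<subseteq> H"
    by (metis card_2_iff)
  then show thesis using e that by (cases "u = x") (auto simp: insert_commute)
qed

lemma perfect_matchings_remove_edge: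
  assumes "M \<in> perfect_matchings H" "e \<in> M"
  shows "M - {e} \<in> perfect_matchings (H - e)"
  using assms perfect_matchings_edge_eq[OF assms(1)]
  unfolding perfect_matchings_def partition_on_def
  by (auto simp: disjoint_def)

lemma perfect_matchings_insert_edge:
  assumes "M \<in> perfect_matchings (H - e)" "card e = 2" "e \<subseteq> H"
  shows "insert e M \<in> perfect_matchings H" "e \<notin> M"
proof -
  have "\<Union>M = H - e" using assms(1) by (auto simp: perfect_matchings_def partition_on_def)
  moreover have "e \<noteq> {}" using assms(2) by auto
  ultimately show "insert e M \<in> perfect_matchings H" "e \<notin> M"
    using assms unfolding perfect_matchings_def partition_on_def by (auto simp: disjoint_def)
qed

text \<open>Conditioning on an edge leaves a uniform perfect matching of the remaining points. The
  forbidden sets \<open>S\<close> lose that edge as well.\<close>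

lemma card_perfect_matchings_condition_edge:
  assumes "card e = 2" "e \<subseteq> H" "e \<notin> F"
  shows "card {M \<in> perfect_matchings H. insert e F \<subseteq> M \<and> avoiding S M}
       = card {M \<in> perfect_matchings (H - e). F \<subseteq> M \<and> avoiding ((\<lambda>B. B - {e}) ` S) M}"
proof (rule bij_betw_same_card[OF bij_betw_byWitness[where f' = "insert e"]])
  let ?A = "{M \<in> perfect_matchings H. insert e F \<subseteq> M \<and> avoiding S M}"
  let ?B = "{M \<in> perfect_matchings (H - e). F \<subseteq> M \<and> avoiding ((\<lambda>B. B - {e}) ` S) M}"
  show "\<forall>M\<in>?A. insert e (M - {e}) = M" by auto
  show "\<forall>M\<in>?B. insert e M - {e} = M"
    using perfect_matchings_insert_edge(2)[OF _ assms(1,2)] by auto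
  show "(\<lambda>M. M - {e}) ` ?A \<subseteq> ?B"
    using perfect_matchings_remove_edge[of _ H e] assms(3) by auto
  show "insert e ` ?B \<subseteq> ?A"
    using perfect_matchings_insert_edge(1)[OF _ assms(1,2)] by auto
qed

lemma perfect_matchings_transpose:
  assumes "M \<in> perfect_matchings H" "v \<in> H" "w \<in> H"
  shows "(`) (Transposition.transpose v w) ` M \<in> perfect_matchings H"
proof -
  let ?t = "Transposition.transpose v w"
  have inj: "inj ?t" by simp
  have "?t ` H = H" using assms(2,3) by (auto simp: transpose_image_eq)
  moreover have "\<Union>((`) ?t ` M) = ?t ` \<Union>M" by auto
  moreover have "card (?t ` e) = card e" for e
    by (rule card_image) (rule inj_on_subset[OF inj subset_UNIV])
  moreover have "disjoint ((`) ?t ` M)" if "disjoint M"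
    using that unfolding disjoint_def by (auto simp flip: image_Int[OF inj])
  ultimately show ?thesis
    using assms(1) by (auto simp: perfect_matchings_def partition_on_def)
qed

text \<open>The switching: exchanging the partners of \<open>v\<close> and \<open>w\<close> moves the edge \<open>{u, v}\<close> to
  \<open>{u, w}\<close>. A forbidden set that contains \<open>{u, v}\<close> is destroyed, and one that touches neither
  \<open>u\<close> nor \<open>v\<close> cannot be created: if it is present afterwards, then it does not touch \<open>w\<close> either, whose
  partner is now \<open>u\<close>, so the exchange did not affect it.\<close>

lemma card_switch_edge_le:
  assumes H: "finite H" "u \<in> H" "v \<in> H" "w \<in> H" "u \<noteq> v" "u \<noteq> w"
    and S: "\<And>B. B \<in> S \<Longrightarrow> {u, v} \<in> B \<or> u \<notin> \<Union>B \<and> v \<notin> \<Union>B"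
  shows "card {M \<in> perfect_matchings H. {u, v} \<in> M \<and> avoiding S M}
       \<le> card {M \<in> perfect_matchings H. {u, w} \<in> M \<and> avoiding S M}"
proof (cases "v = w")
  case False
  let ?t = "Transposition.transpose v w"
  let ?A = "{M \<in> perfect_matchings H. {u, v} \<in> M \<and> avoiding S M}"
  let ?B = "{M \<in> perfect_matchings H. {u, w} \<in> M \<and> avoiding S M}"
  have tt: "(`) ?t ` (`) ?t ` M = M" for M
    by (simp add: image_image)
  have tuv: "?t ` {u, v} = {u, w}" using H by simp
  show ?thesis
  proof (rule card_inj_on_le[where f = "(`) ((`) ?t)"])
    show "inj_on ((`) ((`) ?t)) ?A" by (rule inj_on_inverseI[of _ "(`) ((`) ?t)"]) (rule tt)
    show "finite ?B" using finite_perfect_matchings[OF H(1)] by simp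
    show "(`) ((`) ?t) ` ?A \<subseteq> ?B"
    proof clarify
      fix M assume M: "M \<in> perfect_matchings H" "{u, v} \<in> M" and av: "avoiding S M"
      let ?M = "(`) ?t ` M"
      have M': "?M \<in> perfect_matchings H" by (rule perfect_matchings_transpose[OF M(1) H(3,4)])
      have uw: "{u, w} \<in> ?M" unfolding tuv[symmetric] by (rule imageI[OF M(2)])
      have "\<not> B \<subseteq> ?M" if B: "B \<in> S" for B
      proof
        assume sub: "B \<subseteq> ?M"
        have "{u, v} \<notin> ?M"
          using perfect_matchings_edge_eq[OF M' uw, of "{u, v}" u] False H by (auto simp: doubleton_eq_iff)
        with sub S[OF B] have nt: "u \<notin> \<Union>B" "v \<notin> \<Union>B" by auto
        have "B \<subseteq> M"
        proof
          fix e assume e: "e \<in> B"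
          then obtain e' where e': "e' \<in> M" "e = ?t ` e'" using sub by auto
          have "w \<notin> e"
            using perfect_matchings_edge_eq[OF M' uw, of e w] e sub nt(1) by blast
          moreover have "v \<notin> e" using nt e by auto
          ultimately have "?t ` e = e"
            by (force simp: transpose_def image_iff)
          moreover have "?t ` e = e'" by (simp add: e'(2) image_image)
          ultimately show "e \<in> M" using e'(1) by simp
        qed
        then show False using av B by blast
      qed
      then show "?M \<in> perfect_matchings H \<and> {u, w} \<in> ?M \<and> avoiding S ?M"
        using M' uw by blast
    qed
  qed
qed simp

lemma card_avoiding_by_partner:
  assumes "finite H" "u \<in> H"
  shows "card {M \<in> perfect_matchings H. avoiding S M}
       = (\<Sum>w\<in>H - {u}. card {M \<in> perfect_matchings H. {u, w} \<in> M \<and> avoiding S M})"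
proof -
  have "{M \<in> perfect_matchings H. avoiding S M}
      = (\<Union>w\<in>H - {u}. {M \<in> perfect_matchings H. {u, w} \<in> M \<and> avoiding S M})"
  proof (intro equalityI subsetI)
    fix M assume M: "M \<in> {M \<in> perfect_matchings H. avoiding S M}"
    then have "M \<in> perfect_matchings H" by simp
    from perfect_matchings_coverE[OF this assms(2)] obtain w where "w \<in> H - {u}" "{u, w} \<in> M"
      by blast
    with M show "M \<in> (\<Union>w\<in>H - {u}. {M \<in> perfect_matchings H. {u, w} \<in> M \<and> avoiding S M})"
      by blast
  qed auto
  moreover have "w = w'" if "M \<in> perfect_matchings H" "{u, w} \<in> M" "{u, w'} \<in> M" for M w w'
    using perfect_matchings_edge_eq[OF that, of u] by (auto simp: doubleton_eq_iff)
  then have "card (\<Union>w\<in>H - {u}. {M \<in> perfect_matchings H. {u, w} \<in> M \<and> avoiding S M})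
      = (\<Sum>w\<in>H - {u}. card {M \<in> perfect_matchings H. {u, w} \<in> M \<and> avoiding S M})"
    using assms finite_perfect_matchings[OF assms(1)]
    by (intro card_UN_disjoint ballI impI) (simp, simp, blast)
  ultimately show ?thesis by simp
qed

lemma card_containing_edge_le:
  assumes "finite H" "u \<in> H" "v \<in> H" "u \<noteq> v"
    and "\<And>B. B \<in> S \<Longrightarrow> {u, v} \<in> B \<or> u \<notin> \<Union>B \<and> v \<notin> \<Union>B"
  shows "(card H - 1) * card {M \<in> perfect_matchings H. {u, v} \<in> M \<and> avoiding S M}
       \<le> card {M \<in> perfect_matchings H. avoiding S M}"
proof -
  have "(card H - 1) * card {M \<in> perfect_matchings H. {u, v} \<in> M \<and> avoiding S M}
      = (\<Sum>w\<in>H - {u}. card {M \<in> perfect_matchings H. {u, v} \<in> M \<and> avoiding S M})"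
    using assms(1,2) by simp
  also have "\<dots> \<le> (\<Sum>w\<in>H - {u}. card {M \<in> perfect_matchings H. {u, w} \<in> M \<and> avoiding S M})"
    by (intro sum_mono card_switch_edge_le assms) auto
  also have "\<dots> = card {M \<in> perfect_matchings H. avoiding S M}"
    by (rule card_avoiding_by_partner[OF assms(1,2), symmetric])
  finally show ?thesis .
qed

lemma card_containing_edge_eq:
  assumes "finite H" "u \<in> H" "v \<in> H" "u \<noteq> v"
  shows "(card H - 1) * card {M \<in> perfect_matchings H. {u, v} \<in> M}
       = card (perfect_matchings H)"
proof -
  have le: "card {M \<in> perfect_matchings H. {u, v} \<in> M} \<le> card {M \<in> perfect_matchings H. {u, w} \<in> M}"
    if "v \<in> H" "w \<in> H" "u \<noteq> v" "u \<noteq> w" for v w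
    using card_switch_edge_le[OF assms(1,2) that, of "{}"] by simp
  have "(card H - 1) * card {M \<in> perfect_matchings H. {u, v} \<in> M}
      = (\<Sum>w\<in>H - {u}. card {M \<in> perfect_matchings H. {u, v} \<in> M})"
    using assms by simp
  also have "\<dots> = (\<Sum>w\<in>H - {u}. card {M \<in> perfect_matchings H. {u, w} \<in> M})"
  proof (rule sum.cong[OF refl])
    fix w assume "w \<in> H - {u}"
    then show "card {M \<in> perfect_matchings H. {u, v} \<in> M}
        = card {M \<in> perfect_matchings H. {u, w} \<in> M}"
      using assms by (intro antisym le) auto
  qed
  finally show ?thesis using card_avoiding_by_partner[OF assms(1,2), of "{}"] by simp
qed

text \<open>\<open>odd_ff k m = (m - 1) (m - 3) \<dots> (m - 2 k + 1)\<close> is the number of ways to choose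
  partners for \<open>k\<close> points of an \<open>m\<close>-point set one after the other, so its inverse is the probability
  of \<open>k\<close> prescribed edges.\<close>

primrec odd_ff :: "nat \<Rightarrow> real \<Rightarrow> real" where
  "odd_ff 0 m = 1"
| "odd_ff (Suc k) m = (m - 1) * odd_ff k (m - 2)"

lemma odd_ff_pos: "2 * real k \<le> m \<Longrightarrow> odd_ff k m > 0"
  by (induction k arbitrary: m) auto

definition partial_matching :: "'a set \<Rightarrow> 'a set set \<Rightarrow> bool" where
  "partial_matching H F \<longleftrightarrow> finite F \<and> disjoint F \<and> (\<forall>e\<in>F. card e = 2 \<and> e \<subseteq> H)"

lemma partial_matching_insertD:
  assumes "partial_matching H (insert e F)" "e \<notin> F"
  shows "card e = 2" "e \<subseteq> H" "partial_matching (H - e) F"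
  using assms unfolding partial_matching_def disjoint_def by auto

lemma card_Diff_edge:
  assumes "finite H" "card e = 2" "e \<subseteq> H"
  shows "real (card (H - e)) = real (card H) - 2" "2 \<le> card H"
proof -
  show *: "2 \<le> card H" using card_mono[OF assms(1,3)] assms(2) by simp
  have "finite e" using assms finite_subset by auto
  then show "real (card (H - e)) = real (card H) - 2"
    using card_Diff_subset[of e H] assms * by simp
qed

lemma card_partial_matching:
  assumes "partial_matching H F" "finite H"
  shows "card (\<Union>F) = 2 * card F" "2 * card F \<le> card H"
proof -
  have "finite e" if "e \<in> F" for e
    using that assms finite_subset[of e H] by (simp add: partial_matching_def)
  then have "card (\<Union>F) = sum card F"
    using assms by (intro card_Union_disjoint)
      (auto simp: partial_matching_def disjoint_def pairwise_def disjnt_def)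
  then show *: "card (\<Union>F) = 2 * card F" using assms by (simp add: partial_matching_def)
  have "card (\<Union>F) \<le> card H"
    using assms by (intro card_mono) (auto simp: partial_matching_def)
  then show "2 * card F \<le> card H" using * by simp
qed

lemma odd_ff_partial_matching_pos:
  assumes "partial_matching H F" "finite H"
  shows "odd_ff (card F) (real (card H)) > 0"
  using card_partial_matching(2)[OF assms] by (intro odd_ff_pos) linarith

definition conflicting :: "'a set set \<Rightarrow> 'a set set \<Rightarrow> bool" where
  "conflicting F B \<longleftrightarrow> (\<exists>e\<in>F. \<exists>e'\<in>B. e \<noteq> e' \<and> e \<inter> e' \<noteq> {})"

text \<open>Negative dependence: the edges of \<open>F\<close> are added one at a time, each by a switching.\<close>

lemma card_containing_avoiding_le:
  assumes "finite H" "partial_matching H F" "\<And>B. B \<in> S \<Longrightarrow> \<not> conflicting F B"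
  shows "odd_ff (card F) (real (card H))
           * real (card {M \<in> perfect_matchings H. F \<subseteq> M \<and> avoiding S M})
       \<le> real (card {M \<in> perfect_matchings H. avoiding S M})"
proof -
  have "finite F" using assms(2) by (simp add: partial_matching_def)
  then show ?thesis using assms
  proof (induction F arbitrary: H S rule: finite_induct)
    case (insert e F)
    note e = partial_matching_insertD[OF insert.prems(2) insert.hyps(2)]
    note cH = card_Diff_edge[OF insert.prems(1) e(1,2)]
    let ?S = "(\<lambda>B. B - {e}) ` S"
    obtain u v where uv: "e = {u, v}" "u \<noteq> v" using e(1) by (meson card_2_iff)
    have "\<not> conflicting F B" if "B \<in> ?S" for B
    proof -
      from that obtain B' where "B' \<in> S" "B = B' - {e}" by blast
      with insert.prems(3)[of B'] show ?thesis by (auto simp: conflicting_def)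
    qed
    then have IH: "odd_ff (card F) (real (card (H - e)))
           * real (card {M \<in> perfect_matchings (H - e). F \<subseteq> M \<and> avoiding ?S M})
       \<le> real (card {M \<in> perfect_matchings (H - e). avoiding ?S M})"
      using e insert.prems(1) by (intro insert.IH) auto
    have "odd_ff (card (insert e F)) (real (card H))
           * real (card {M \<in> perfect_matchings H. insert e F \<subseteq> M \<and> avoiding S M})
      = (real (card H) - 1) * (odd_ff (card F) (real (card (H - e)))
           * real (card {M \<in> perfect_matchings (H - e). F \<subseteq> M \<and> avoiding ?S M}))"
      unfolding card_perfect_matchings_condition_edge[OF e(1,2) insert.hyps(2)]
      using insert.hyps cH by simp
    also have "\<dots> \<le> (real (card H) - 1)
           * real (card {M \<in> perfect_matchings (H - e). avoiding ?S M})"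
      using IH cH by (intro mult_left_mono) auto
    also have "\<dots> = real ((card H - 1) * card {M \<in> perfect_matchings H. {u, v} \<in> M \<and> avoiding S M})"
      using card_perfect_matchings_condition_edge[OF e(1,2), of "{}" S] cH uv by simp
    also have "\<dots> \<le> real (card {M \<in> perfect_matchings H. avoiding S M})"
    proof (rule of_nat_mono, rule card_containing_edge_le)
      fix B assume "B \<in> S"
      then have "\<not> conflicting (insert e F) B" by (rule insert.prems)
      then have "e = e'" if "e' \<in> B" "e \<inter> e' \<noteq> {}" for e'
        using that unfolding conflicting_def by blast
      then show "{u, v} \<in> B \<or> u \<notin> \<Union>B \<and> v \<notin> \<Union>B"
        unfolding uv(1) by auto
    qed (use insert.prems(1) e(2) uv in auto)
    finally show ?case .
  qed simp
qed

lemma card_containing: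
  assumes "finite H" "partial_matching H F"
  shows "odd_ff (card F) (real (card H)) * real (card {M \<in> perfect_matchings H. F \<subseteq> M})
       = real (card (perfect_matchings H))"
proof -
  have "finite F" using assms(2) by (simp add: partial_matching_def)
  then show ?thesis using assms
  proof (induction F arbitrary: H rule: finite_induct)
    case (insert e F)
    note e = partial_matching_insertD[OF insert.prems(2) insert.hyps(2)]
    note cH = card_Diff_edge[OF insert.prems(1) e(1,2)]
    obtain u v where uv: "e = {u, v}" "u \<noteq> v" using e(1) by (meson card_2_iff)
    have IH: "odd_ff (card F) (real (card (H - e)))
           * real (card {M \<in> perfect_matchings (H - e). F \<subseteq> M})
       = real (card (perfect_matchings (H - e)))"
      using e insert.prems(1) by (intro insert.IH) auto
    have "odd_ff (card (insert e F)) (real (card H))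
           * real (card {M \<in> perfect_matchings H. insert e F \<subseteq> M})
      = (real (card H) - 1) * (odd_ff (card F) (real (card (H - e)))
           * real (card {M \<in> perfect_matchings (H - e). F \<subseteq> M}))"
      using card_perfect_matchings_condition_edge[OF e(1,2) insert.hyps(2), of "{}"]
      using insert.hyps cH by simp
    also have "\<dots> = (real (card H) - 1) * real (card (perfect_matchings (H - e)))"
      using IH by simp
    also have "\<dots> = real ((card H - 1) * card {M \<in> perfect_matchings H. {u, v} \<in> M})"
      using card_perfect_matchings_condition_edge[OF e(1,2), of "{}" "{}"] cH uv by simp
    also have "\<dots> = real (card (perfect_matchings H))"
      using card_containing_edge_eq[of H u v] insert.prems e uv by auto
    finally show ?case .
  qed simp
qed

lemma perfect_matchings_nonempty:
  assumes "finite H" "even (card H)"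
  shows "perfect_matchings H \<noteq> {}"
  using assms
proof (induction "card H" arbitrary: H rule: less_induct)
  case less
  show ?case
  proof (cases "H = {}")
    case True
    then have "{} \<in> perfect_matchings H"
      by (auto simp: perfect_matchings_def partition_on_def disjoint_def)
    then show ?thesis by auto
  next
    case False
    then have "2 \<le> card H" using less.prems
      by (metis One_nat_def Suc_leI card_gt_0_iff even_Suc_Suc_iff le_antisym not_less_eq_eq numeral_2_eq_2 odd_one)
    then obtain e where e: "e \<subseteq> H" "card e = 2" by (meson obtain_subset_with_card_n)
    note c = card_Diff_edge[OF less.prems(1) e(2,1)]
    have "card (H - e) = card H - 2" using c by linarith
    then have "perfect_matchings (H - e) \<noteq> {}"
      using c less.prems by (intro less.hyps) auto
    then show ?thesis using perfect_matchings_insert_edge(1)[OF _ e(2,1)] by blast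
  qed
qed

lemma prob_perfect_matchings:
  assumes "finite H" "even (card H)"
  shows "measure_pmf.prob (pmf_of_set (perfect_matchings H)) {M. P M}
       = real (card {M \<in> perfect_matchings H. P M}) / real (card (perfect_matchings H))"
  using assms perfect_matchings_nonempty finite_perfect_matchings
  by (subst measure_pmf_of_set) (auto simp: Int_def)

lemma expectation_perfect_matchings:
  fixes f :: "'a set set \<Rightarrow> real"
  assumes "finite H" "even (card H)"
  shows "measure_pmf.expectation (pmf_of_set (perfect_matchings H)) f
       = (\<Sum>M\<in>perfect_matchings H. f M) / real (card (perfect_matchings H))"
  using assms perfect_matchings_nonempty finite_perfect_matchings
  by (subst integral_pmf_of_set) auto

section \<open>The local lemma for random matchings\<close>

text \<open>The induction of the local lemma, with counts instead of conditional probabilities. Forbidden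
  sets that do not conflict with \<open>F\<close> only make \<open>F\<close> less likely, and those that do conflict with \<open>F\<close>
  together remove at most half of the matchings that avoid the others.\<close>

lemma local_lemma_conditional:
  fixes \<F> :: "'a set set set"
  defines "p \<equiv> \<lambda>F H. 1 / odd_ff (card F) (real (card H))"
  assumes H: "finite H" "finite \<F>" "\<And>F. F \<in> \<F> \<Longrightarrow> partial_matching H F"
    and dep: "\<And>F. F \<in> \<F> \<Longrightarrow> (\<Sum>B\<in>{B\<in>\<F>. conflicting F B}. p B H) \<le> 1 / 4"
    and "S \<subseteq> \<F>" "F \<in> \<F>"
  shows "real (card {M \<in> perfect_matchings H. F \<subseteq> M \<and> avoiding S M})
       \<le> 2 * p F H * real (card {M \<in> perfect_matchings H. avoiding S M})"
  using assms(6,7)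
proof (induction "card S" arbitrary: S F rule: less_induct)
  case less
  let ?P = "perfect_matchings H"
  let ?a = "\<lambda>S. real (card {M \<in> ?P. avoiding S M})"
  have finP: "finite ?P" using finite_perfect_matchings[OF H(1)] .
  have finS: "finite S" using less.prems H(2) finite_subset by blast
  have p0: "p B H \<ge> 0" if "B \<in> \<F>" for B
    unfolding p_def using odd_ff_partial_matching_pos[OF H(3)[OF that] H(1)] by simp
  define S1 where "S1 = {B\<in>S. \<not> conflicting F B}"
  define S2 where "S2 = {B\<in>S. conflicting F B}"
  have "card {M \<in> ?P. F \<subseteq> M \<and> avoiding S M} \<le> card {M \<in> ?P. F \<subseteq> M \<and> avoiding S1 M}"
    using finP by (intro card_mono) (auto simp: S1_def)
  moreover have "odd_ff (card F) (real (card H)) * real (card {M \<in> ?P. F \<subseteq> M \<and> avoiding S1 M}) \<le> ?a S1"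
    by (rule card_containing_avoiding_le) (use H less.prems in \<open>auto simp: S1_def\<close>)
  then have "real (card {M \<in> ?P. F \<subseteq> M \<and> avoiding S1 M}) \<le> p F H * ?a S1"
    using odd_ff_partial_matching_pos[OF H(3)[OF less.prems(2)] H(1)] by (simp add: p_def field_simps)
  moreover have "p F H * ?a S1 \<le> p F H * (2 * ?a S)"
  proof (rule mult_left_mono[OF _ p0[OF less.prems(2)]])
    show "?a S1 \<le> 2 * ?a S"
    proof (cases "S2 = {}")
      case True
      then have "S1 = S" by (auto simp: S1_def S2_def)
      then show ?thesis by simp
    next
      case False
      then have lt: "card S1 < card S"
        using finS by (intro psubset_card_mono) (auto simp: S1_def S2_def)
      have "{M \<in> ?P. avoiding S1 M}
          \<subseteq> {M \<in> ?P. avoiding S M} \<union> (\<Union>B\<in>S2. {M \<in> ?P. B \<subseteq> M \<and> avoiding S1 M})"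
        by (auto simp: S1_def S2_def)
      then have "card {M \<in> ?P. avoiding S1 M}
          \<le> card ({M \<in> ?P. avoiding S M} \<union> (\<Union>B\<in>S2. {M \<in> ?P. B \<subseteq> M \<and> avoiding S1 M}))"
        using finP finS by (intro card_mono) (auto simp: S2_def)
      also have "\<dots> \<le> card {M \<in> ?P. avoiding S M} + card (\<Union>B\<in>S2. {M \<in> ?P. B \<subseteq> M \<and> avoiding S1 M})"
        by (rule card_Un_le)
      also have "\<dots> \<le> card {M \<in> ?P. avoiding S M} + (\<Sum>B\<in>S2. card {M \<in> ?P. B \<subseteq> M \<and> avoiding S1 M})"
        using finS by (intro add_left_mono card_UN_le) (auto simp: S2_def)
      finally have "?a S1 \<le> ?a S + (\<Sum>B\<in>S2. real (card {M \<in> ?P. B \<subseteq> M \<and> avoiding S1 M}))"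
        by (simp flip: of_nat_sum of_nat_add)
      also have "\<dots> \<le> ?a S + (\<Sum>B\<in>S2. 2 * p B H * ?a S1)"
        using less.prems by (intro add_left_mono sum_mono less.hyps[OF lt]) (auto simp: S1_def S2_def)
      also have "\<dots> = ?a S + 2 * ?a S1 * (\<Sum>B\<in>S2. p B H)"
        by (simp add: sum_distrib_left sum_distrib_right mult_ac)
      also have "\<dots> \<le> ?a S + 2 * ?a S1 * (1 / 4)"
      proof (intro add_left_mono mult_left_mono)
        have "(\<Sum>B\<in>S2. p B H) \<le> (\<Sum>B\<in>{B\<in>\<F>. conflicting F B}. p B H)"
          using H(2) p0 less.prems by (intro sum_mono2) (auto simp: S2_def)
        also have "\<dots> \<le> 1 / 4" by (rule dep[OF less.prems(2)])
        finally show "(\<Sum>B\<in>S2. p B H) \<le> 1 / 4" .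
      qed simp
      finally show ?thesis by simp
    qed
  qed
  ultimately show ?case by (simp add: mult_ac)
qed

text \<open>Forbidding the sets one after the other, each step keeps at least the fraction \<open>1 - 2 p F\<close>.\<close>

lemma local_lemma:
  fixes \<F> :: "'a set set set"
  defines "p \<equiv> \<lambda>F H. 1 / odd_ff (card F) (real (card H))"
  assumes H: "finite H" "finite \<F>" "\<And>F. F \<in> \<F> \<Longrightarrow> partial_matching H F"
    and dep: "\<And>F. F \<in> \<F> \<Longrightarrow> (\<Sum>B\<in>{B\<in>\<F>. conflicting F B}. p B H) \<le> 1 / 4"
    and small: "\<And>F. F \<in> \<F> \<Longrightarrow> p F H \<le> 1 / 2"
  shows "(\<Prod>F\<in>\<F>. 1 - 2 * p F H) * real (card (perfect_matchings H))
       \<le> real (card {M \<in> perfect_matchings H. avoiding \<F> M})"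
proof -
  let ?P = "perfect_matchings H"
  have "(\<Prod>F\<in>S. 1 - 2 * p F H) * real (card ?P) \<le> real (card {M \<in> ?P. avoiding S M})"
    if "finite S" "S \<subseteq> \<F>" for S
    using that
  proof (induction S rule: finite_induct)
    case (insert F S)
    have fin: "finite ?P" using finite_perfect_matchings[OF H(1)] .
    have "{M \<in> ?P. avoiding (insert F S) M}
        = {M \<in> ?P. avoiding S M} - {M \<in> ?P. F \<subseteq> M \<and> avoiding S M}" by auto
    then have "card {M \<in> ?P. avoiding (insert F S) M}
        = card {M \<in> ?P. avoiding S M} - card {M \<in> ?P. F \<subseteq> M \<and> avoiding S M}"
      by (simp only:) (rule card_Diff_subset, use fin in auto)
    moreover have "card {M \<in> ?P. F \<subseteq> M \<and> avoiding S M} \<le> card {M \<in> ?P. avoiding S M}"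
      using fin by (intro card_mono) auto
    ultimately have eq: "real (card {M \<in> ?P. avoiding (insert F S) M})
        = real (card {M \<in> ?P. avoiding S M}) - real (card {M \<in> ?P. F \<subseteq> M \<and> avoiding S M})"
      by simp
    have "(\<Prod>F\<in>insert F S. 1 - 2 * p F H) * real (card ?P)
        = (1 - 2 * p F H) * ((\<Prod>F\<in>S. 1 - 2 * p F H) * real (card ?P))"
      using insert.hyps by simp
    also have "\<dots> \<le> (1 - 2 * p F H) * real (card {M \<in> ?P. avoiding S M})"
      using insert small[of F] by (intro mult_left_mono) auto
    also have "\<dots> \<le> real (card {M \<in> ?P. avoiding (insert F S) M})"
      using local_lemma_conditional[OF H dep[unfolded p_def], of S F] insert.prems
      unfolding eq p_def by (simp add: algebra_simps)
    finally show ?case .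
  qed simp
  then show ?thesis using H(2) by auto
qed

section \<open>Edges and triangles of the configuration model\<close>

definition half_edges_at :: "(nat \<Rightarrow> nat) \<Rightarrow> nat \<Rightarrow> (nat \<times> nat) set" where
  "half_edges_at d i = {i} \<times> {..<d i}"

lemma mem_half_edges_at [simp]: "h \<in> half_edges_at d i \<longleftrightarrow> fst h = i \<and> snd h < d i"
  by (cases h) (auto simp: half_edges_at_def)

lemma finite_half_edges_at [simp]: "finite (half_edges_at d i)"
  and card_half_edges_at [simp]: "card (half_edges_at d i) = d i"
  by (simp_all add: half_edges_at_def card_cartesian_product)

lemma half_edges_eq_UN: "half_edges n d = (\<Union>i\<in>{1..n}. half_edges_at d i)"
  by (auto simp: half_edges_def)

lemma mem_half_edges: "h \<in> half_edges n d \<longleftrightarrow> fst h \<in> {1..n} \<and> snd h < d (fst h)"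
  by (cases h) (auto simp: half_edges_def)

lemma finite_half_edges [simp]: "finite (half_edges n d)"
  by (simp add: half_edges_eq_UN)

lemma sum_half_edges: "(\<Sum>h\<in>half_edges n d. f h) = (\<Sum>i\<in>{1..n}. \<Sum>h\<in>half_edges_at d i. f h)"
  unfolding half_edges_eq_UN by (rule sum.UNION_disjoint) auto

lemma card_half_edges: "card (half_edges n d) = (\<Sum>i\<in>{1..n}. d i)"
  by (simp add: half_edges_def)

lemma real_card_half_edges: "real (card (half_edges n d)) = deg_moment n d 1"
  by (simp add: card_half_edges deg_moment_def)

lemma pairings_eq: "pairings n d = perfect_matchings (half_edges n d)"
  by (simp add: pairings_def perfect_matchings_def)

lemma adj_commute: "adj M i j = adj M j i"
  by (auto simp: adj_def insert_commute)

text \<open>Counting ordered pairs of matched half-edges counts each self-loop twice, which is the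
  convention for the diagonal entries.\<close>

lemma adj_eq_card:
  assumes M: "M \<in> perfect_matchings (half_edges n d)" and ij: "i \<in> {1..n}" "j \<in> {1..n}"
  shows "adj M i j = card {(h, h'). h \<in> half_edges_at d i \<and> h' \<in> half_edges_at d j \<and> {h, h'} \<in> M}"
proof -
  let ?E = "{e \<in> M. fst ` e = {i, j}}"
  let ?Q = "\<lambda>e. {(h, h'). {h, h'} = e \<and> fst h = i \<and> fst h' = j}"
  have "M \<subseteq> Pow (half_edges n d)" using perfect_matchings_edgeD(2)[OF M] by auto
  then have finM: "finite M" by (rule finite_subset) simp
  have cardQ: "card (?Q e) = (if i = j then 2 else 1)" and finQ: "finite (?Q e)" if e: "e \<in> ?E" for e
  proof -
    obtain x y where xy: "e = {x, y}" "x \<noteq> y"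
      using e perfect_matchings_edgeD(1)[OF M, of e] by (auto simp: card_2_iff)
    with e have f: "{fst x, fst y} = {i, j}" by auto
    have "?Q e = (if i = j then {(x, y), (y, x)} else if fst x = i then {(x, y)} else {(y, x)})"
      using f unfolding xy(1) by (auto simp: doubleton_eq_iff)
    then show "card (?Q e) = (if i = j then 2 else 1)" "finite (?Q e)"
      using xy by auto
  qed
  have "{(h, h'). h \<in> half_edges_at d i \<and> h' \<in> half_edges_at d j \<and> {h, h'} \<in> M} = (\<Union>e\<in>?E. ?Q e)"
    using perfect_matchings_edgeD(2)[OF M] by (fastforce simp: mem_half_edges)
  also have "card \<dots> = (\<Sum>e\<in>?E. card (?Q e))"
    using finM finQ by (intro card_UN_disjoint ballI impI) auto
  also have "\<dots> = (\<Sum>e\<in>?E. if i = j then 2 else 1)"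
    using cardQ by (intro sum.cong) auto
  also have "\<dots> = adj M i j" by (simp add: adj_def)
  finally show ?thesis ..
qed

lemma real_adj_eq_sum:
  assumes "M \<in> perfect_matchings (half_edges n d)" "i \<in> {1..n}" "j \<in> {1..n}"
  shows "real (adj M i j)
       = (\<Sum>h\<in>half_edges_at d i. \<Sum>h'\<in>half_edges_at d j. of_bool ({h, h'} \<in> M))"
proof -
  have "{(h, h'). h \<in> half_edges_at d i \<and> h' \<in> half_edges_at d j \<and> {h, h'} \<in> M}
      = (half_edges_at d i \<times> half_edges_at d j) \<inter> {x. {fst x, snd x} \<in> M}" by auto
  then have "real (adj M i j)
      = (\<Sum>x\<in>half_edges_at d i \<times> half_edges_at d j. of_bool ({fst x, snd x} \<in> M))"
    unfolding adj_eq_card[OF assms] by (simp add: Int_def)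
  then show ?thesis by (simp only: sum.cartesian_product case_prod_unfold)
qed

lemma weighted_row_sum:
  assumes M: "M \<in> perfect_matchings (half_edges n d)" and j: "j \<in> {1..n}"
  shows "(\<Sum>i\<in>{1..n}. real (adj M i j) / real (d i))
       = (\<Sum>h\<in>half_edges_at d j. \<Sum>h'\<in>half_edges n d. of_bool ({h, h'} \<in> M) * (1 / real (d (fst h'))))"
proof -
  have "(\<Sum>i\<in>{1..n}. real (adj M i j) / real (d i))
      = (\<Sum>i\<in>{1..n}. \<Sum>h\<in>half_edges_at d j. \<Sum>h'\<in>half_edges_at d i.
           of_bool ({h, h'} \<in> M) * (1 / real (d (fst h'))))"
  proof (rule sum.cong[OF refl])
    fix i assume i: "i \<in> {1..n}"
    show "real (adj M i j) / real (d i) = (\<Sum>h\<in>half_edges_at d j. \<Sum>h'\<in>half_edges_at d i.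
           of_bool ({h, h'} \<in> M) * (1 / real (d (fst h'))))"
      unfolding adj_commute[of M i j] real_adj_eq_sum[OF M j i] sum_divide_distrib
      by (intro sum.cong refl) simp
  qed
  also have "\<dots> = (\<Sum>h\<in>half_edges_at d j. \<Sum>i\<in>{1..n}. \<Sum>h'\<in>half_edges_at d i.
           of_bool ({h, h'} \<in> M) * (1 / real (d (fst h'))))"
    by (rule sum.swap)
  finally show ?thesis by (simp only: sum_half_edges)
qed

text \<open>A wedge is an ordered pair of distinct half-edges at one vertex. Three wedges at different
  vertices span a labelled triangle, whose edges join the second half-edge of each wedge to the
  first half-edge of the next one.\<close>

definition wedges :: "(nat \<Rightarrow> nat) \<Rightarrow> nat \<Rightarrow> ((nat \<times> nat) \<times> (nat \<times> nat)) set" where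
  "wedges d i = {(h, h'). h \<in> half_edges_at d i \<and> h' \<in> half_edges_at d i \<and> h \<noteq> h'}"

lemma mem_wedges: "w \<in> wedges d i \<longleftrightarrow>
    fst w \<in> half_edges_at d i \<and> snd w \<in> half_edges_at d i \<and> fst w \<noteq> snd w"
  by (cases w) (simp add: wedges_def)

lemma wedges_eq: "wedges d i = (SIGMA h:half_edges_at d i. half_edges_at d i - {h})"
  by (auto simp: wedges_def)

lemma finite_wedges [simp]: "finite (wedges d i)"
  unfolding wedges_eq by (intro finite_SigmaI) auto

lemma card_wedges: "real (card (wedges d i)) = real (d i) * (real (d i) - 1)"
proof -
  have "card (wedges d i) = (\<Sum>h\<in>half_edges_at d i. card (half_edges_at d i - {h}))"
    unfolding wedges_eq by (rule card_SigmaI) auto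
  also have "\<dots> = (\<Sum>h\<in>half_edges_at d i. d i - 1)"
    by (intro sum.cong refl) (subst card_Diff_singleton, simp_all)
  finally show ?thesis by (cases "d i") (auto simp: algebra_simps)
qed

definition triangle :: "'a \<times> 'a \<Rightarrow> 'a \<times> 'a \<Rightarrow> 'a \<times> 'a \<Rightarrow> 'a set set" where
  "triangle u v w = {{snd u, fst v}, {snd v, fst w}, {snd w, fst u}}"

text \<open>The half-edges that the edges \<open>i j\<close> and \<open>j k\<close> use at \<open>j\<close> are different, because a half-edge lies
  in one pair only and the other endpoints differ. So the two always form a wedge.\<close>

lemma adj_product_eq_card:
  assumes M: "M \<in> perfect_matchings (half_edges n d)"
    and ijk: "i \<in> {1..n}" "j \<in> {1..n}" "k \<in> {1..n}" "i \<noteq> j" "j \<noteq> k" "k \<noteq> i"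
  shows "adj M i j * adj M j k * adj M k i
       = card {(u, v, w). u \<in> wedges d i \<and> v \<in> wedges d j \<and> w \<in> wedges d k \<and> triangle u v w \<subseteq> M}"
proof -
  let ?P = "\<lambda>i j. {(h, h'). h \<in> half_edges_at d i \<and> h' \<in> half_edges_at d j \<and> {h, h'} \<in> M}"
  have "adj M i j * adj M j k * adj M k i = card (?P i j \<times> ?P j k \<times> ?P k i)"
    using adj_eq_card[OF M] ijk by (simp add: card_cartesian_product)
  also have "\<dots> = card {(u, v, w). u \<in> wedges d i \<and> v \<in> wedges d j \<and> w \<in> wedges d k
      \<and> triangle u v w \<subseteq> M}" (is "_ = card ?T")
  proof (rule bij_betw_same_card)
    let ?f = "\<lambda>((a', b), (b', c), (c', a)). ((a, a'), (b, b'), (c, c'))"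
    let ?g = "\<lambda>((a, a'), (b, b'), (c, c')). ((a', b), (b', c), (c', a))"
    show "bij_betw ?f (?P i j \<times> ?P j k \<times> ?P k i) ?T"
    proof (rule bij_betw_byWitness[where f' = ?g])
      show "\<forall>x\<in>?P i j \<times> ?P j k \<times> ?P k i. ?g (?f x) = x" by auto
      show "\<forall>x\<in>?T. ?f (?g x) = x" by auto
      show "?f ` (?P i j \<times> ?P j k \<times> ?P k i) \<subseteq> ?T"
      proof (rule image_subsetI)
        fix x assume x: "x \<in> ?P i j \<times> ?P j k \<times> ?P k i"
        obtain a' b b' c c' a where [simp]: "x = ((a', b), (b', c), (c', a))" by (metis surj_pair)
        have mem: "a \<in> half_edges_at d i" "a' \<in> half_edges_at d i" "b \<in> half_edges_at d j"
          "b' \<in> half_edges_at d j" "c \<in> half_edges_at d k" "c' \<in> half_edges_at d k"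
          and e: "{a', b} \<in> M" "{b', c} \<in> M" "{c', a} \<in> M" using x by auto
        have "{a', b} \<noteq> {c', a}" "{a', b} \<noteq> {b', c}" "{b', c} \<noteq> {c', a}"
          using mem ijk(4-6) by (auto simp: doubleton_eq_iff)
        then have "a \<noteq> a'" "b \<noteq> b'" "c \<noteq> c'"
          using perfect_matchings_edge_eq[OF M e(1,3), of a] perfect_matchings_edge_eq[OF M e(1,2), of b]
            perfect_matchings_edge_eq[OF M e(2,3), of c] by auto
        then show "?f x \<in> ?T" using mem e by (auto simp: wedges_def triangle_def)
      qed
      show "?g ` ?T \<subseteq> ?P i j \<times> ?P j k \<times> ?P k i"
        by (auto simp: wedges_def triangle_def)
    qed
  qed
  finally show ?thesis .
qed

lemma adj_product_eq_sum:
  assumes "M \<in> perfect_matchings (half_edges n d)"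
    and "i \<in> {1..n}" "j \<in> {1..n}" "k \<in> {1..n}" "i \<noteq> j" "j \<noteq> k" "k \<noteq> i"
  shows "real (adj M i j * adj M j k * adj M k i)
       = (\<Sum>(u, v, w)\<in>wedges d i \<times> wedges d j \<times> wedges d k. of_bool (triangle u v w \<subseteq> M))"
proof -
  have "{(u, v, w). u \<in> wedges d i \<and> v \<in> wedges d j \<and> w \<in> wedges d k \<and> triangle u v w \<subseteq> M}
      = (wedges d i \<times> wedges d j \<times> wedges d k) \<inter> {(u, v, w). triangle u v w \<subseteq> M}" by auto
  then show ?thesis
    unfolding adj_product_eq_card[OF assms] by (simp add: case_prod_unfold Int_def)
qed

definition distinct_triples :: "'a set \<Rightarrow> ('a \<times> 'a \<times> 'a) set" where
  "distinct_triples A = {(i, j, k). i \<in> A \<and> j \<in> A \<and> k \<in> A \<and> i \<noteq> j \<and> j \<noteq> k \<and> k \<noteq> i}"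

lemma sum_triangles:
  "(\<Sum>i\<in>{1..n}. triangles n M i * f i)
     = (\<Sum>(i, j, k)\<in>distinct_triples {1..n}. real (adj M i j * adj M j k * adj M k i) * f i) / 2"
proof -
  let ?B = "\<lambda>i. {(j, k). j \<in> {1..n} \<and> k \<in> {1..n} \<and> i \<noteq> j \<and> j \<noteq> k \<and> k \<noteq> i}"
  have fin: "finite (?B i)" for i
    by (rule finite_subset[of _ "{1..n} \<times> {1..n}"]) auto
  have *: "distinct_triples {1..n} = Sigma {1..n} ?B" by (auto simp: distinct_triples_def)
  show ?thesis
    unfolding * triangles_def using fin
    by (subst sum.Sigma[symmetric])
      (simp_all add: case_prod_unfold sum_distrib_right sum_divide_distrib)
qed

text \<open>Exchanging the two summations, each triangle at \<open>i\<close> contributes the sum of the inverse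
  degrees of the neighbours of \<open>i\<close>, minus one.\<close>

lemma bias_eq:
  assumes d: "degree_sequence n d" and M: "M \<in> perfect_matchings (half_edges n d)"
  shows "real n * bias n d M = (\<Sum>(i, j, k)\<in>distinct_triples {1..n}.
     \<Sum>(u, v, w)\<in>wedges d i \<times> wedges d j \<times> wedges d k.
       of_bool (triangle u v w \<subseteq> M) * ((\<Sum>h\<in>half_edges_at d i. \<Sum>h'\<in>half_edges n d.
            of_bool ({h, h'} \<in> M) * (1 / real (d (fst h')))) - 1)) / 2"
proof -
  have d0: "d i \<noteq> 0" if "i \<in> {1..n}" for i using d that by (force simp: degree_sequence_def)
  have "real n * bias n d M = (\<Sum>i\<in>{1..n}. bias_at n d M i)"
    by (cases "n = 0") (simp_all add: bias_def)
  also have "\<dots> = (\<Sum>i\<in>{1..n}. (\<Sum>j\<in>{1..n}. triangles n M j * (real (adj M i j) / real (d i))) - triangles n M i)"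
    using d0 by (intro sum.cong refl) (simp add: bias_at_def sum_divide_distrib mult_ac)
  also have "\<dots> = (\<Sum>j\<in>{1..n}. \<Sum>i\<in>{1..n}. triangles n M j * (real (adj M i j) / real (d i)))
      - (\<Sum>j\<in>{1..n}. triangles n M j)"
    unfolding sum_subtractf by (subst sum.swap) simp
  also have "\<dots> = (\<Sum>j\<in>{1..n}. triangles n M j * ((\<Sum>i\<in>{1..n}. real (adj M i j) / real (d i)) - 1))"
    by (simp add: sum_subtractf sum_distrib_left right_diff_distrib)
  also have "\<dots> = (\<Sum>(i, j, k)\<in>distinct_triples {1..n}. real (adj M i j * adj M j k * adj M k i) *
      ((\<Sum>x\<in>{1..n}. real (adj M x i) / real (d x)) - 1)) / 2"
    by (rule sum_triangles)
  also have "(\<Sum>(i, j, k)\<in>distinct_triples {1..n}. real (adj M i j * adj M j k * adj M k i) *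
      ((\<Sum>x\<in>{1..n}. real (adj M x i) / real (d x)) - 1)) =
    (\<Sum>(i, j, k)\<in>distinct_triples {1..n}.
     \<Sum>(u, v, w)\<in>wedges d i \<times> wedges d j \<times> wedges d k.
       of_bool (triangle u v w \<subseteq> M) * ((\<Sum>h\<in>half_edges_at d i. \<Sum>h'\<in>half_edges n d.
            of_bool ({h, h'} \<in> M) * (1 / real (d (fst h')))) - 1))"
  proof (rule sum.cong[OF refl], clarify)
    fix i j k assume "(i, j, k) \<in> distinct_triples {1..n}"
    then have ijk: "i \<in> {1..n}" "j \<in> {1..n}" "k \<in> {1..n}" "i \<noteq> j" "j \<noteq> k" "k \<noteq> i"
      by (auto simp: distinct_triples_def)
    show "real (adj M i j * adj M j k * adj M k i) * ((\<Sum>x\<in>{1..n}. real (adj M x i) / real (d x)) - 1) =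
      (\<Sum>(u, v, w)\<in>wedges d i \<times> wedges d j \<times> wedges d k.
       of_bool (triangle u v w \<subseteq> M) * ((\<Sum>h\<in>half_edges_at d i. \<Sum>h'\<in>half_edges n d.
            of_bool ({h, h'} \<in> M) * (1 / real (d (fst h')))) - 1))"
      unfolding adj_product_eq_sum[OF M ijk] weighted_row_sum[OF M ijk(1)] sum_distrib_right
      by (simp only: case_prod_unfold)
  qed
  finally show ?thesis .
qed

lemma partial_matching_triangle:
  assumes "u \<in> wedges d i" "v \<in> wedges d j" "w \<in> wedges d k" "(i, j, k) \<in> distinct_triples {1..n}"
  shows "partial_matching (half_edges n d) (triangle u v w)" "card (triangle u v w) = 3"
  using assms
  by (auto simp: partial_matching_def triangle_def mem_wedges distinct_triples_def disjoint_def
      mem_half_edges card_insert_if doubleton_eq_iff)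

section \<open>The expected bias\<close>

lemma expectation_containing:
  assumes "finite H" "even (card H)" "partial_matching H F"
  shows "measure_pmf.expectation (pmf_of_set (perfect_matchings H)) (\<lambda>M. of_bool (F \<subseteq> M))
       = 1 / odd_ff (card F) (real (card H))"
proof -
  have "card (perfect_matchings H) \<noteq> 0"
    using finite_perfect_matchings perfect_matchings_nonempty assms by (metis card_0_eq)
  moreover have "(\<Sum>M\<in>perfect_matchings H. of_bool (F \<subseteq> M)) = real (card {M \<in> perfect_matchings H. F \<subseteq> M})"
    using finite_perfect_matchings[OF assms(1)] by (simp add: Int_def)
  moreover note card_containing[OF assms(1,3)] odd_ff_partial_matching_pos[OF assms(3,1)]
  ultimately show ?thesis
    unfolding expectation_perfect_matchings[OF assms(1,2)]
    by (simp add: field_simps)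
qed

lemma expectation_sum_perfect_matchings:
  fixes f :: "'b \<Rightarrow> 'a set set \<Rightarrow> real"
  assumes "finite H" "even (card H)"
  shows "measure_pmf.expectation (pmf_of_set (perfect_matchings H)) (\<lambda>M. \<Sum>x\<in>I. f x M)
       = (\<Sum>x\<in>I. measure_pmf.expectation (pmf_of_set (perfect_matchings H)) (f x))"
  unfolding expectation_perfect_matchings[OF assms] sum_divide_distrib[symmetric]
  by (subst sum.swap) (rule refl)

text \<open>A half-edge of \<open>F\<close> has its partner in \<open>F\<close>; every other one is equally likely to be matched to
  any of the points that are not covered by \<open>F\<close>.\<close>

lemma expectation_partner_covered:
  fixes g :: "'a \<Rightarrow> real"
  assumes H: "finite H" "even (card H)" and F: "partial_matching H F" "{h, x} \<in> F"
  shows "measure_pmf.expectation (pmf_of_set (perfect_matchings H))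
           (\<lambda>M. of_bool (F \<subseteq> M) * (\<Sum>h'\<in>H. of_bool ({h, h'} \<in> M) * g h'))
       = g x / odd_ff (card F) (real (card H))"
proof -
  have x: "x \<in> H" using F by (auto simp: partial_matching_def)
  have "of_bool (F \<subseteq> M) * (\<Sum>h'\<in>H. of_bool ({h, h'} \<in> M) * g h') = of_bool (F \<subseteq> M) * g x"
    if M: "M \<in> perfect_matchings H" for M
  proof (cases "F \<subseteq> M")
    case True
    then have "{h, h'} \<in> M \<longleftrightarrow> h' = x" for h'
      using perfect_matchings_edge_eq[OF M, of "{h, h'}" "{h, x}" h] F(2)
      by (auto simp: doubleton_eq_iff)
    then have "(\<Sum>h'\<in>H. of_bool ({h, h'} \<in> M) * g h') = g x"
      using H(1) x by (simp add: of_bool_def if_distrib[of "\<lambda>y. y * _"] cong: if_cong)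
    then show ?thesis by simp
  qed simp
  then have "(\<Sum>M\<in>perfect_matchings H. of_bool (F \<subseteq> M) * (\<Sum>h'\<in>H. of_bool ({h, h'} \<in> M) * g h'))
      = (\<Sum>M\<in>perfect_matchings H. of_bool (F \<subseteq> M)) * g x"
    unfolding sum_distrib_right by (rule sum.cong[OF refl])
  then show ?thesis
    using expectation_containing[OF H F(1)]
    unfolding expectation_perfect_matchings[OF H] by (metis times_divide_eq_left mult_1)
qed

lemma expectation_partner_free:
  fixes g :: "'a \<Rightarrow> real"
  assumes H: "finite H" "even (card H)" and F: "partial_matching H F" and h: "h \<in> H" "h \<notin> \<Union>F"
  shows "measure_pmf.expectation (pmf_of_set (perfect_matchings H))
           (\<lambda>M. of_bool (F \<subseteq> M) * (\<Sum>h'\<in>H. of_bool ({h, h'} \<in> M) * g h'))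
       = (\<Sum>h'\<in>H - \<Union>F - {h}. g h') / odd_ff (Suc (card F)) (real (card H))"
proof -
  let ?E = "measure_pmf.expectation (pmf_of_set (perfect_matchings H))"
  have "?E (\<lambda>M. of_bool (F \<subseteq> M) * (\<Sum>h'\<in>H. of_bool ({h, h'} \<in> M) * g h'))
      = ?E (\<lambda>M. \<Sum>h'\<in>H. of_bool (insert {h, h'} F \<subseteq> M) * g h')"
    by (rule arg_cong[where f = ?E]) (auto simp: fun_eq_iff sum_distrib_left)
  also have "\<dots> = (\<Sum>h'\<in>H. ?E (\<lambda>M. of_bool (insert {h, h'} F \<subseteq> M)) * g h')"
    by (simp add: expectation_sum_perfect_matchings[OF H])
  also have "\<dots> = (\<Sum>h'\<in>H - \<Union>F - {h}. ?E (\<lambda>M. of_bool (insert {h, h'} F \<subseteq> M)) * g h')"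
  proof (rule sum.mono_neutral_right[OF H(1)])
    show "\<forall>h'\<in>H - (H - \<Union>F - {h}). ?E (\<lambda>M. of_bool (insert {h, h'} F \<subseteq> M)) * g h' = 0"
    proof
      fix h' assume "h' \<in> H - (H - \<Union>F - {h})"
      then have h': "h' \<in> H" "h' \<in> \<Union>F \<or> h' = h" by auto
      have zero: "of_bool (insert {h, h'} F \<subseteq> M) = (0 :: real)" if M: "M \<in> perfect_matchings H" for M
      proof (rule ccontr)
        assume "\<not> ?thesis"
        then have sub: "{h, h'} \<in> M" "F \<subseteq> M" by (auto split: if_splits)
        from sub(1) have "h' \<noteq> h" using perfect_matchings_edgeD(1)[OF M sub(1)] by auto
        with h'(2) obtain e where e: "e \<in> F" "h' \<in> e" by auto
        then have "{h, h'} = e" using perfect_matchings_edge_eq[OF M sub(1), of e h'] sub(2) by auto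
        then show False using e h(2) by auto
      qed
      show "?E (\<lambda>M. of_bool (insert {h, h'} F \<subseteq> M)) * g h' = 0"
        unfolding expectation_perfect_matchings[OF H]
        by (subst sum.neutral) (use zero in blast, simp)
    qed
  qed auto
  also have "\<dots> = (\<Sum>h'\<in>H - \<Union>F - {h}. g h' / odd_ff (Suc (card F)) (real (card H)))"
  proof (rule sum.cong[OF refl])
    fix h' assume h': "h' \<in> H - \<Union>F - {h}"
    then have "partial_matching H (insert {h, h'} F)" "{h, h'} \<notin> F"
      using F h by (auto simp: partial_matching_def disjoint_def)
    then show "?E (\<lambda>M. of_bool (insert {h, h'} F \<subseteq> M)) * g h'
        = g h' / odd_ff (Suc (card F)) (real (card H))"
      using expectation_containing[OF H, of "insert {h, h'} F"] F
      by (simp add: partial_matching_def del: odd_ff.simps)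
  qed
  finally show ?thesis by (simp add: sum_divide_distrib)
qed

text \<open>The contribution of one labelled triangle. Of the \<open>d i\<close> half-edges at \<open>i\<close>, two belong to the
  triangle and lead to \<open>j\<close> and \<open>k\<close>. The others have a uniform partner. The inverse degrees sum to
  \<open>n\<close> over all half-edges, and the six half-edges of the triangle and \<open>h\<close> itself are excluded.\<close>

lemma expectation_triangle_weight:
  fixes n :: nat and d :: "nat \<Rightarrow> nat"
  defines "H \<equiv> half_edges n d" and "m \<equiv> deg_moment n d 1"
  assumes d: "degree_sequence n d"
    and ijk: "(i, j, k) \<in> distinct_triples {1..n}"
    and uvw: "u \<in> wedges d i" "v \<in> wedges d j" "w \<in> wedges d k"
  shows "measure_pmf.expectation (pmf_of_set (perfect_matchings H))
      (\<lambda>M. of_bool (triangle u v w \<subseteq> M) * ((\<Sum>h\<in>half_edges_at d i. \<Sum>h'\<in>H.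
            of_bool ({h, h'} \<in> M) * (1 / real (d (fst h')))) - 1))
    = (1 / real (d j) + 1 / real (d k) - 1) / odd_ff 3 m
      + (real (d i) - 2) * (real n - 3 / real (d i) - 2 / real (d j) - 2 / real (d k)) / odd_ff 4 m"
proof -
  let ?E = "measure_pmf.expectation (pmf_of_set (perfect_matchings H))"
  let ?F = "triangle u v w"
  let ?g = "\<lambda>h. 1 / real (d (fst h))"
  let ?W = "\<lambda>h M. of_bool (?F \<subseteq> M) * (\<Sum>h'\<in>H. of_bool ({h, h'} \<in> M) * ?g h')"
  have m: "real (card H) = m" by (simp add: H_def m_def real_card_half_edges)
  have H: "finite H" "even (card H)"
    using d by (simp_all add: H_def card_half_edges degree_sequence_def)
  note F = partial_matching_triangle[OF uvw ijk, folded H_def]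
  have dne: "i \<noteq> j" "j \<noteq> k" "k \<noteq> i" "i \<in> {1..n}" "j \<in> {1..n}" "k \<in> {1..n}"
    using ijk by (auto simp: distinct_triples_def)
  have at: "fst u \<in> half_edges_at d i" "snd u \<in> half_edges_at d i" "fst u \<noteq> snd u"
    "fst v \<in> half_edges_at d j" "snd v \<in> half_edges_at d j" "fst v \<noteq> snd v"
    "fst w \<in> half_edges_at d k" "snd w \<in> half_edges_at d k" "fst w \<noteq> snd w"
    using uvw by (auto simp: mem_wedges)
  have UF: "\<Union>?F = {fst u, snd u, fst v, snd v, fst w, snd w}"
    by (auto simp: triangle_def)
  have sumH: "(\<Sum>h\<in>H. ?g h) = real n"
  proof -
    have "(\<Sum>h\<in>half_edges_at d x. ?g h) = 1" if "x \<in> {1..n}" for x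
    proof -
      have "(\<Sum>h\<in>half_edges_at d x. ?g h) = (\<Sum>h\<in>half_edges_at d x. 1 / real (d x))"
        by (intro sum.cong) auto
      also have "\<dots> = 1" using d that by (force simp: degree_sequence_def)
      finally show ?thesis .
    qed
    then show ?thesis by (simp add: H_def sum_half_edges)
  qed
  have "?E (?W h) = (real n - 3 / real (d i) - 2 / real (d j) - 2 / real (d k)) / odd_ff 4 m"
    if h: "h \<in> half_edges_at d i - {fst u, snd u}" for h
  proof -
    have hH: "h \<in> H" using h dne by (auto simp: H_def mem_half_edges)
    have hF: "h \<notin> \<Union>?F" unfolding UF using h at dne by auto
    have "(\<Sum>x\<in>H - \<Union>?F - {h}. ?g x) = (\<Sum>x\<in>H. ?g x) - (\<Sum>x\<in>insert h (\<Union>?F). ?g x)"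
      using H(1) F(1) hH
      by (subst sum_diff[symmetric]) (auto simp: partial_matching_def intro!: sum.cong)
    also have "(\<Sum>x\<in>insert h (\<Union>?F). ?g x) = ?g h + (\<Sum>x\<in>\<Union>?F. ?g x)"
      using hF by (intro sum.insert) (auto simp: UF)
    also have "(\<Sum>x\<in>\<Union>?F. ?g x) = 2 / real (d i) + 2 / real (d j) + 2 / real (d k)"
    proof -
      have "distinct [fst u, snd u, fst v, snd v, fst w, snd w]" using at dne by auto
      then show ?thesis unfolding UF using at by simp
    qed
    finally have "(\<Sum>x\<in>H - \<Union>?F - {h}. ?g x)
        = real n - 3 / real (d i) - 2 / real (d j) - 2 / real (d k)"
      using h sumH by simp
    then show ?thesis
      using expectation_partner_free[OF H F(1) hH hF, of ?g] F(2) m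
      by (simp add: numeral_eq_Suc del: odd_ff.simps)
  qed
  then have "(\<Sum>h\<in>half_edges_at d i - {fst u, snd u}. ?E (?W h)) = real (card (half_edges_at d i - {fst u, snd u})) *
      ((real n - 3 / real (d i) - 2 / real (d j) - 2 / real (d k)) / odd_ff 4 m)"
    by simp
  also have "real (card (half_edges_at d i - {fst u, snd u})) = real (d i) - 2"
  proof -
    have "{fst u, snd u} \<subseteq> half_edges_at d i" "card {fst u, snd u} = 2" using at by auto
    then show ?thesis
      using card_Diff_edge(1)[of "half_edges_at d i" "{fst u, snd u}"] by simp
  qed
  finally have rest: "(\<Sum>h\<in>half_edges_at d i - {fst u, snd u}. ?E (?W h)) =
      (real (d i) - 2) * ((real n - 3 / real (d i) - 2 / real (d j) - 2 / real (d k)) / odd_ff 4 m)" .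
  have "{fst u, snd w} \<in> ?F" "{snd u, fst v} \<in> ?F" by (auto simp: triangle_def)
  then have two: "?E (?W (fst u)) = 1 / real (d k) / odd_ff 3 m" "?E (?W (snd u)) = 1 / real (d j) / odd_ff 3 m"
    using expectation_partner_covered[OF H F(1), of _ _ ?g] F(2) m at by auto
  have "half_edges_at d i = insert (fst u) (insert (snd u) (half_edges_at d i - {fst u, snd u}))"
    using at by auto
  then have "(\<Sum>h\<in>half_edges_at d i. ?E (?W h))
      = (\<Sum>h\<in>insert (fst u) (insert (snd u) (half_edges_at d i - {fst u, snd u})). ?E (?W h))"
    by (rule arg_cong)
  then have split: "(\<Sum>h\<in>half_edges_at d i. ?E (?W h)) = ?E (?W (fst u)) + (?E (?W (snd u))
      + (\<Sum>h\<in>half_edges_at d i - {fst u, snd u}. ?E (?W h)))"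
    using at(3) by (simp del: mem_half_edges_at)
  have "?E (\<lambda>M. of_bool (?F \<subseteq> M) * ((\<Sum>h\<in>half_edges_at d i. \<Sum>h'\<in>H.
            of_bool ({h, h'} \<in> M) * ?g h') - 1))
      = ?E (\<lambda>M. \<Sum>h\<in>half_edges_at d i. ?W h M) - ?E (\<lambda>M. of_bool (?F \<subseteq> M))"
    unfolding expectation_perfect_matchings[OF H] diff_divide_distrib[symmetric] sum_subtractf[symmetric]
    by (simp add: sum_distrib_left right_diff_distrib)
  also have "\<dots> = (\<Sum>h\<in>half_edges_at d i. ?E (?W h)) - 1 / odd_ff 3 m"
    using expectation_containing[OF H F(1)] F(2) m
    unfolding expectation_sum_perfect_matchings[OF H] by simp
  moreover have "1 / z / p + (1 / y / p + a * (b / q)) - 1 / p = (1 / y + 1 / z - 1) / p + a * b / q"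
    for y z p q a b :: real by (simp add: diff_divide_distrib add_divide_distrib)
  ultimately show ?thesis unfolding split two rest by simp
qed

lemma expectation_bias_eq_sum:
  fixes n :: nat and d :: "nat \<Rightarrow> nat"
  defines "m \<equiv> deg_moment n d 1"
  assumes d: "degree_sequence n d"
  shows "measure_pmf.expectation (config_model n d) (\<lambda>M. real n * bias n d M)
    = (\<Sum>(i, j, k)\<in>distinct_triples {1..n}.
        real (d i) * (real (d i) - 1) * (real (d j) * (real (d j) - 1)) * (real (d k) * (real (d k) - 1)) *
        ((1 / real (d j) + 1 / real (d k) - 1) / odd_ff 3 m
         + (real (d i) - 2) * (real n - 3 / real (d i) - 2 / real (d j) - 2 / real (d k)) / odd_ff 4 m)) / 2"
proof -
  let ?H = "half_edges n d"
  let ?E = "measure_pmf.expectation (pmf_of_set (perfect_matchings ?H))"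
  have H: "finite ?H" "even (card ?H)"
    using d by (simp_all add: card_half_edges degree_sequence_def)
  define X where "X i u v w M = of_bool (triangle u v w \<subseteq> M) * ((\<Sum>h\<in>half_edges_at d i. \<Sum>h'\<in>?H.
            of_bool ({h, h'} \<in> M) * (1 / real (d (fst h')))) - 1)" for i u v w M
  define c where "c i j k = (1 / real (d j) + 1 / real (d k) - 1) / odd_ff 3 m
      + (real (d i) - 2) * (real n - 3 / real (d i) - 2 / real (d j) - 2 / real (d k)) / odd_ff 4 m"
    for i j k
  have E: "?E f = ?E g" if "\<And>M. M \<in> perfect_matchings ?H \<Longrightarrow> f M = g M" for f g :: "_ \<Rightarrow> real"
    unfolding expectation_perfect_matchings[OF H] using that by simp
  have "?E (\<lambda>M. real n * bias n d M) = ?E (\<lambda>M. (\<Sum>(i, j, k)\<in>distinct_triples {1..n}.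
     \<Sum>(u, v, w)\<in>wedges d i \<times> wedges d j \<times> wedges d k. X i u v w M) / 2)"
    by (rule E) (simp only: bias_eq[OF d] X_def)
  also have "\<dots> = (\<Sum>(i, j, k)\<in>distinct_triples {1..n}.
     \<Sum>(u, v, w)\<in>wedges d i \<times> wedges d j \<times> wedges d k. ?E (X i u v w)) / 2"
    by (simp add: case_prod_unfold expectation_sum_perfect_matchings[OF H])
  also have "(\<Sum>(i, j, k)\<in>distinct_triples {1..n}.
     \<Sum>(u, v, w)\<in>wedges d i \<times> wedges d j \<times> wedges d k. ?E (X i u v w))
    = (\<Sum>(i, j, k)\<in>distinct_triples {1..n}.
        real (d i) * (real (d i) - 1) * (real (d j) * (real (d j) - 1)) * (real (d k) * (real (d k) - 1)) * c i j k)"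
  proof (rule sum.cong[OF refl], clarify)
    fix i j k assume ijk: "(i, j, k) \<in> distinct_triples {1..n}"
    have "(\<Sum>(u, v, w)\<in>wedges d i \<times> wedges d j \<times> wedges d k. ?E (X i u v w))
        = (\<Sum>(u, v, w)\<in>wedges d i \<times> wedges d j \<times> wedges d k. c i j k)"
      using expectation_triangle_weight[OF d ijk] unfolding X_def c_def m_def
      by (intro sum.cong) auto
    also have "\<dots> = real (d i) * (real (d i) - 1) * (real (d j) * (real (d j) - 1)) * (real (d k) * (real (d k) - 1)) * c i j k"
      by (simp add: card_cartesian_product card_wedges)
    finally show "(\<Sum>(u, v, w)\<in>wedges d i \<times> wedges d j \<times> wedges d k. ?E (X i u v w)) =
       real (d i) * (real (d i) - 1) * (real (d j) * (real (d j) - 1)) * (real (d k) * (real (d k) - 1)) * c i j k" .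
  qed
  finally show ?thesis by (simp only: config_model_def pairings_eq c_def)
qed

text \<open>Inclusion-exclusion over coincidences. Any two of the three equalities imply the third, so the
  full coincidence is subtracted three times by the pairs and has to be added back twice.\<close>

lemma sum_distinct_triples:
  fixes f g h :: "'a \<Rightarrow> 'b::comm_ring_1"
  assumes "finite A"
  shows "(\<Sum>(i, j, k)\<in>distinct_triples A. f i * g j * h k)
    = (\<Sum>i\<in>A. f i) * (\<Sum>i\<in>A. g i) * (\<Sum>i\<in>A. h i)
      - (\<Sum>i\<in>A. f i * g i) * (\<Sum>i\<in>A. h i) - (\<Sum>i\<in>A. f i * h i) * (\<Sum>i\<in>A. g i)
      - (\<Sum>i\<in>A. g i * h i) * (\<Sum>i\<in>A. f i) + 2 * (\<Sum>i\<in>A. f i * g i * h i)"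
proof -
  have delta: "(\<Sum>j\<in>A. of_bool (i = j) * g j) = g i" "(\<Sum>j\<in>A. of_bool (j = i) * g j) = g i"
    if "i \<in> A" for i and g :: "'a \<Rightarrow> 'b"
    using assms that by (simp_all add: of_bool_def if_distrib[of "\<lambda>y. y * _"] cong: if_cong)
  define T where "T = (\<lambda>(i, j, k). f i * g j * h k)"
  have "(\<Sum>x\<in>distinct_triples A. T x)
      = (\<Sum>x\<in>A \<times> A \<times> A. (case x of (i, j, k) \<Rightarrow> of_bool (i \<noteq> j \<and> j \<noteq> k \<and> k \<noteq> i)) * T x)"
    using assms by (intro sum.mono_neutral_cong_left) (auto simp: distinct_triples_def)
  also have "\<dots> = (\<Sum>i\<in>A. \<Sum>j\<in>A. \<Sum>k\<in>A. of_bool (i \<noteq> j \<and> j \<noteq> k \<and> k \<noteq> i) * T (i, j, k))"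
    by (simp only: sum.cartesian_product case_prod_unfold fst_conv snd_conv prod.collapse)
  also have "\<dots> = (\<Sum>i\<in>A. \<Sum>j\<in>A. \<Sum>k\<in>A. T (i, j, k) - of_bool (i = j) * T (i, j, k)
      - of_bool (j = k) * T (i, j, k) - of_bool (k = i) * T (i, j, k)
      + 2 * (of_bool (i = j) * (of_bool (j = k) * T (i, j, k))))"
    by (intro sum.cong refl) auto
  also have "\<dots> = (\<Sum>i\<in>A. \<Sum>j\<in>A. \<Sum>k\<in>A. T (i, j, k))
      - (\<Sum>i\<in>A. \<Sum>j\<in>A. of_bool (i = j) * (\<Sum>k\<in>A. T (i, j, k)))
      - (\<Sum>i\<in>A. \<Sum>j\<in>A. \<Sum>k\<in>A. of_bool (j = k) * T (i, j, k))
      - (\<Sum>i\<in>A. \<Sum>j\<in>A. \<Sum>k\<in>A. of_bool (k = i) * T (i, j, k))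
      + 2 * (\<Sum>i\<in>A. \<Sum>j\<in>A. of_bool (i = j) * (\<Sum>k\<in>A. of_bool (j = k) * T (i, j, k)))"
    by (simp only: sum.distrib sum_subtractf sum_distrib_left)
  also have "\<dots> = (\<Sum>i\<in>A. \<Sum>j\<in>A. \<Sum>k\<in>A. T (i, j, k)) - (\<Sum>i\<in>A. \<Sum>k\<in>A. T (i, i, k))
      - (\<Sum>i\<in>A. \<Sum>j\<in>A. T (i, j, j)) - (\<Sum>i\<in>A. \<Sum>j\<in>A. T (i, j, i)) + 2 * (\<Sum>i\<in>A. T (i, i, i))"
    by (simp add: delta cong: sum.cong)
  also have "(\<Sum>i\<in>A. \<Sum>j\<in>A. \<Sum>k\<in>A. T (i, j, k)) = (\<Sum>i\<in>A. f i) * (\<Sum>i\<in>A. g i) * (\<Sum>i\<in>A. h i)"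
    by (simp add: T_def sum_distrib_left[symmetric] sum_distrib_right[symmetric])
  also have "(\<Sum>i\<in>A. \<Sum>k\<in>A. T (i, i, k)) = (\<Sum>i\<in>A. f i * g i) * (\<Sum>i\<in>A. h i)"
    by (simp add: T_def sum_distrib_left[symmetric] sum_distrib_right[symmetric])
  also have "(\<Sum>i\<in>A. \<Sum>j\<in>A. T (i, j, j)) = (\<Sum>i\<in>A. g i * h i) * (\<Sum>i\<in>A. f i)"
    by (subst sum.swap, subst sum_product) (simp add: T_def mult_ac)
  also have "(\<Sum>i\<in>A. \<Sum>j\<in>A. T (i, j, i)) = (\<Sum>i\<in>A. f i * h i) * (\<Sum>i\<in>A. g i)"
    by (subst sum_product) (simp add: T_def mult_ac)
  finally show ?thesis by (simp add: T_def case_prod_unfold)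
qed

text \<open>With \<open>d (d - 1)\<close> wedges at a vertex of degree \<open>d\<close>, clearing the inverse degrees turns the contribution
  of a triple into a sum of seven products of polynomials in the three degrees.\<close>

lemma expectation_bias_moments:
  fixes n :: nat and d :: "nat \<Rightarrow> nat"
  defines "m \<equiv> deg_moment n d"
  assumes d: "degree_sequence n d" and m7: "m 1 > 7"
  shows "measure_pmf.expectation (config_model n d) (\<lambda>M. real n * bias n d M)
    = ((6*m 1*m 3 - 18*m 1*m 4 + 14*m 1*m 5 - 2*m 1*m 6 + 4*m 2*m 3 - 8*m 2*m 4 + 4*m 3^2
        - 14*m 1*m 2*m 3 + 3*m 1*m 2*m 4 - 9*m 1^2*m 2 + 18*m 1^2*m 3 - 5*m 1^2*m 4
        + 3*m 1*m 2^2 + 4*m 2^3 - 7*m 1^3*m 2 - m 1*m 2^3 + 5*m 1^2*m 2^2 + 3*m 1^4)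
       + real n * (2*m 7 - 10*m 6 + 14*m 5 - 6*m 4
        + 6*m 1*m 3 - 8*m 1*m 4 + 2*m 1*m 5 - 13*m 2*m 3 + 11*m 2*m 4 - 2*m 2*m 5 - m 3*m 4
        + 3*m 2^2 + 2*m 3^2
        - 2*m 1*m 2*m 3 - 3*m 1^2*m 2 + m 1^2*m 3 + 6*m 1*m 2^2 + m 2^2*m 3 - 3*m 2^3))
      / (2 * (m 1 - 1) * (m 1 - 3) * (m 1 - 5) * (m 1 - 7))"
proof -
  define x where "x i = real (d i)" for i
  define l where "l i = x i - 1" for i
  define q where "q i = x i * (x i - 1)" for i
  define e where "e i = (x i - 1) * (x i - 2)" for i
  define c where "c i = x i * (x i - 1) * (x i - 2)" for i
  define P where "P = (m 1 - 1) * (m 1 - 3) * (m 1 - 5) * (m 1 - 7)"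
  have "odd_ff 3 (m 1) = (m 1 - 1) * (m 1 - 3) * (m 1 - 5)" "odd_ff 4 (m 1) = P"
    by (simp_all add: numeral_eq_Suc P_def algebra_simps)
  then have P3: "1 / odd_ff 3 (m 1) = (m 1 - 7) / P" and P4: "odd_ff 4 (m 1) = P"
    using m7 by (simp_all add: P_def)
  have m0: "real n = m 0" by (simp add: m_def deg_moment_def)
  have "measure_pmf.expectation (config_model n d) (\<lambda>M. real n * bias n d M)
    = (\<Sum>(i, j, k)\<in>distinct_triples {1..n}. q i * q j * q k *
        ((1 / x j + 1 / x k - 1) / odd_ff 3 (m 1)
         + (x i - 2) * (real n - 3 / x i - 2 / x j - 2 / x k) / odd_ff 4 (m 1))) / 2"
    unfolding expectation_bias_eq_sum[OF d] by (simp only: q_def x_def m_def)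
  also have "(\<Sum>(i, j, k)\<in>distinct_triples {1..n}. q i * q j * q k *
        ((1 / x j + 1 / x k - 1) / odd_ff 3 (m 1)
         + (x i - 2) * (real n - 3 / x i - 2 / x j - 2 / x k) / odd_ff 4 (m 1)))
    = (\<Sum>(i, j, k)\<in>distinct_triples {1..n}.
        ((m 1 - 7) * (q i * l j * q k) + (m 1 - 7) * (q i * q j * l k) - (m 1 - 7) * (q i * q j * q k)
         + m 0 * (c i * q j * q k) - 3 * (e i * q j * q k) - 2 * (c i * l j * q k) - 2 * (c i * q j * l k)) / P)"
  proof (rule sum.cong[OF refl], clarify)
    fix i j k assume "(i, j, k) \<in> distinct_triples {1..n}"
    then have x0: "x i \<noteq> 0" "x j \<noteq> 0" "x k \<noteq> 0"
      using d by (force simp: distinct_triples_def degree_sequence_def x_def)+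
    have "q i * q j * q k * ((1 / x j + 1 / x k - 1) / odd_ff 3 (m 1))
        = ((m 1 - 7) * (q i * l j * q k) + (m 1 - 7) * (q i * q j * l k) - (m 1 - 7) * (q i * q j * q k)) / P"
    proof -
      have "q j / x j = l j" "q k / x k = l k" using x0 by (simp_all add: q_def l_def)
      moreover have "q i * q j * q k * (1 / x j + 1 / x k - 1)
          = q i * (q j / x j) * q k + q i * q j * (q k / x k) - q i * q j * q k"
        by (simp add: algebra_simps)
      ultimately have eq: "q i * q j * q k * (1 / x j + 1 / x k - 1)
          = q i * l j * q k + q i * q j * l k - q i * q j * q k" by simp
      have "q i * q j * q k * ((1 / x j + 1 / x k - 1) / odd_ff 3 (m 1))
          = q i * q j * q k * (1 / x j + 1 / x k - 1) * (1 / odd_ff 3 (m 1))" by simp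
      also have "\<dots> = (m 1 - 7) * (q i * l j * q k + q i * q j * l k - q i * q j * q k) / P"
        unfolding eq P3 by simp
      finally show ?thesis by (simp add: distrib_left right_diff_distrib)
    qed
    moreover have "q i * q j * q k * ((x i - 2) * (real n - 3 / x i - 2 / x j - 2 / x k) / odd_ff 4 (m 1))
        = (m 0 * (c i * q j * q k) - 3 * (e i * q j * q k) - 2 * (c i * l j * q k) - 2 * (c i * q j * l k)) / P"
    proof -
      have "q j / x j = l j" "q k / x k = l k" "c i / x i = e i" "q i * (x i - 2) = c i"
        using x0 by (simp_all add: q_def l_def c_def e_def)
      moreover have "q i * q j * q k * ((x i - 2) * (real n - 3 / x i - 2 / x j - 2 / x k) / odd_ff 4 (m 1))
          = (real n * ((q i * (x i - 2)) * q j * q k) - 3 * ((q i * (x i - 2)) / x i * q j * q k)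
            - 2 * ((q i * (x i - 2)) * (q j / x j) * q k) - 2 * ((q i * (x i - 2)) * q j * (q k / x k))) / odd_ff 4 (m 1)"
        by (simp add: algebra_simps add_divide_distrib diff_divide_distrib)
      ultimately show ?thesis unfolding P4 m0 by simp
    qed
    ultimately show "q i * q j * q k *
        ((1 / x j + 1 / x k - 1) / odd_ff 3 (m 1)
         + (x i - 2) * (real n - 3 / x i - 2 / x j - 2 / x k) / odd_ff 4 (m 1))
      = ((m 1 - 7) * (q i * l j * q k) + (m 1 - 7) * (q i * q j * l k) - (m 1 - 7) * (q i * q j * q k)
         + m 0 * (c i * q j * q k) - 3 * (e i * q j * q k) - 2 * (c i * l j * q k) - 2 * (c i * q j * l k)) / P"
      unfolding distrib_left by (simp add: add_divide_distrib diff_divide_distrib)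
  qed
  also have "\<dots> = ((m 1 - 7) * (\<Sum>(i, j, k)\<in>distinct_triples {1..n}. q i * l j * q k)
        + (m 1 - 7) * (\<Sum>(i, j, k)\<in>distinct_triples {1..n}. q i * q j * l k)
        - (m 1 - 7) * (\<Sum>(i, j, k)\<in>distinct_triples {1..n}. q i * q j * q k)
        + m 0 * (\<Sum>(i, j, k)\<in>distinct_triples {1..n}. c i * q j * q k)
        - 3 * (\<Sum>(i, j, k)\<in>distinct_triples {1..n}. e i * q j * q k)
        - 2 * (\<Sum>(i, j, k)\<in>distinct_triples {1..n}. c i * l j * q k)
        - 2 * (\<Sum>(i, j, k)\<in>distinct_triples {1..n}. c i * q j * l k)) / P"
    by (simp only: case_prod_unfold sum_divide_distrib[symmetric] sum.distrib sum_subtractf sum_distrib_left)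
  also have "\<dots> = ((6*m 1*m 3 - 18*m 1*m 4 + 14*m 1*m 5 - 2*m 1*m 6 + 4*m 2*m 3 - 8*m 2*m 4 + 4*m 3^2
        - 14*m 1*m 2*m 3 + 3*m 1*m 2*m 4 - 9*m 1^2*m 2 + 18*m 1^2*m 3 - 5*m 1^2*m 4
        + 3*m 1*m 2^2 + 4*m 2^3 - 7*m 1^3*m 2 - m 1*m 2^3 + 5*m 1^2*m 2^2 + 3*m 1^4)
       + m 0 * (2*m 7 - 10*m 6 + 14*m 5 - 6*m 4
        + 6*m 1*m 3 - 8*m 1*m 4 + 2*m 1*m 5 - 13*m 2*m 3 + 11*m 2*m 4 - 2*m 2*m 5 - m 3*m 4
        + 3*m 2^2 + 2*m 3^2
        - 2*m 1*m 2*m 3 - 3*m 1^2*m 2 + m 1^2*m 3 + 6*m 1*m 2^2 + m 2^2*m 3 - 3*m 2^3)) / P"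
  proof -
    note expand = m_def deg_moment_def sum_distrib_left sum.distrib[symmetric] sum_subtractf[symmetric]
      l_def q_def e_def c_def x_def
    have "sum l {1..n} = m 1 - m 0" "sum q {1..n} = m 2 - m 1"
      "sum e {1..n} = m 2 - 3 * m 1 + 2 * m 0" "sum c {1..n} = m 3 - 3 * m 2 + 2 * m 1"
      "(\<Sum>i\<in>{1..n}. q i * l i) = m 3 - 2 * m 2 + m 1"
      "(\<Sum>i\<in>{1..n}. l i * q i) = m 3 - 2 * m 2 + m 1"
      "(\<Sum>i\<in>{1..n}. q i * q i) = m 4 - 2 * m 3 + m 2"
      "(\<Sum>i\<in>{1..n}. c i * q i) = m 5 - 4 * m 4 + 5 * m 3 - 2 * m 2"
      "(\<Sum>i\<in>{1..n}. c i * l i) = m 4 - 4 * m 3 + 5 * m 2 - 2 * m 1"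
      "(\<Sum>i\<in>{1..n}. e i * q i) = m 4 - 4 * m 3 + 5 * m 2 - 2 * m 1"
      "(\<Sum>i\<in>{1..n}. q i * l i * q i) = m 5 - 3 * m 4 + 3 * m 3 - m 2"
      "(\<Sum>i\<in>{1..n}. q i * q i * l i) = m 5 - 3 * m 4 + 3 * m 3 - m 2"
      "(\<Sum>i\<in>{1..n}. q i * q i * q i) = m 6 - 3 * m 5 + 3 * m 4 - m 3"
      "(\<Sum>i\<in>{1..n}. c i * q i * q i) = m 7 - 5 * m 6 + 9 * m 5 - 7 * m 4 + 2 * m 3"
      "(\<Sum>i\<in>{1..n}. e i * q i * q i) = m 6 - 5 * m 5 + 9 * m 4 - 7 * m 3 + 2 * m 2"
      "(\<Sum>i\<in>{1..n}. c i * l i * q i) = m 6 - 5 * m 5 + 9 * m 4 - 7 * m 3 + 2 * m 2"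
      "(\<Sum>i\<in>{1..n}. c i * q i * l i) = m 6 - 5 * m 5 + 9 * m 4 - 7 * m 3 + 2 * m 2"
      unfolding expand by (rule sum.cong[OF refl], algebra)+
    note moments = this
    show ?thesis
      unfolding sum_distinct_triples[OF finite_atLeastAtMost] moments
      by (rule arg_cong[where f = "\<lambda>t. t / P"]) algebra
  qed
  finally have E: "measure_pmf.expectation (config_model n d) (\<lambda>M. real n * bias n d M) = \<dots> / 2" .
  have den: "2 * (m 1 - 1) * (m 1 - 3) * (m 1 - 5) * (m 1 - 7) = P * 2"
    unfolding P_def by algebra
  show ?thesis
    using E unfolding den m0 divide_divide_eq_left .
qed

section \<open>Limits of degree moments\<close>

text \<open>The seventh moment makes lower powers uniformly integrable: on degrees up to \<open>K\<close> the function
  \<open>f\<close> is dominated by a multiple of \<open>g\<close>, and above \<open>K\<close> by the seventh power divided by \<open>K\<close>.\<close>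

lemma mean_tendsto_0_by_truncation:
  fixes f g :: "nat \<Rightarrow> real" and d :: "nat \<Rightarrow> nat \<Rightarrow> nat"
  assumes d: "\<And>n i. i \<in> {1..n} \<Longrightarrow> 1 \<le> d n i"
    and f: "\<And>x. 1 \<le> x \<Longrightarrow> 0 \<le> f x" "\<And>x. 1 \<le> x \<Longrightarrow> f x \<le> B * real x ^ 6"
    and g: "\<And>x. 1 \<le> x \<Longrightarrow> 0 \<le> g x" "\<And>x. 1 \<le> x \<Longrightarrow> f x \<noteq> 0 \<Longrightarrow> 1 \<le> g x"
    and lim_g: "(\<lambda>n. (\<Sum>i\<in>{1..n}. g (d n i)) / real n) \<longlonglongrightarrow> 0"
    and lim_7: "(\<lambda>n. deg_moment n (d n) 7 / real n) \<longlonglongrightarrow> c"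
  shows "(\<lambda>n. (\<Sum>i\<in>{1..n}. f (d n i)) / real n) \<longlonglongrightarrow> 0"
proof (rule order_tendstoI)
  fix a :: real assume "a < 0"
  moreover have "0 \<le> (\<Sum>i\<in>{1..n}. f (d n i)) / real n" for n
    using f(1) d by (intro divide_nonneg_nonneg sum_nonneg) auto
  ultimately show "\<forall>\<^sub>F n in sequentially. a < (\<Sum>i\<in>{1..n}. f (d n i)) / real n"
    by (intro always_eventually allI) (meson less_le_trans)
next
  fix a :: real assume a: "0 < a"
  have B: "0 \<le> B" using f(1)[of 1] f(2)[of 1] by simp
  have c: "0 \<le> c"
    using lim_7 by (rule LIMSEQ_le_const) (auto intro!: divide_nonneg_nonneg sum_nonneg simp: deg_moment_def)
  \<comment> \<open>For this \<open>K\<close> the part above \<open>K\<close> is asymptotically smaller than \<open>a\<close>.\<close>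
  obtain K :: nat where K: "2 * B * (c + 1) / a < real K" using reals_Archimedean2 by blast
  moreover have "0 \<le> 2 * B * (c + 1) / a" using a B c by simp
  ultimately have K0: "0 < real K" by linarith
  have pointwise: "f x \<le> B * real K ^ 6 * g x + B / real K * real x ^ 7" if x: "1 \<le> x" for x
  proof (cases "f x = 0")
    case True
    then show ?thesis using B K0 g(1)[OF x] by simp
  next
    case False
    show ?thesis
    proof (cases "x \<le> K")
      case True
      have "f x \<le> B * real x ^ 6" by (rule f(2)[OF x])
      also have "\<dots> \<le> B * real K ^ 6" using True B by (intro mult_left_mono power_mono) auto
      also have "\<dots> \<le> B * real K ^ 6 * g x"
        using mult_left_mono[OF g(2)[OF x False], of "B * real K ^ 6"] B by simp
      also have "\<dots> \<le> B * real K ^ 6 * g x + B / real K * real x ^ 7" using B by simp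
      finally show ?thesis .
    next
      case False
      have "f x \<le> B * real x ^ 6" by (rule f(2)[OF x])
      also have "\<dots> \<le> B * (real x ^ 6 * (real x / real K))"
        using False B K0 by (intro mult_left_mono) (auto simp: field_simps intro!: mult_left_mono)
      also have "\<dots> = B / real K * real x ^ 7" by (simp add: power_Suc2[symmetric] del: power_Suc)
      also have "\<dots> \<le> B * real K ^ 6 * g x + B / real K * real x ^ 7" using B g(1)[OF x] by simp
      finally show ?thesis .
    qed
  qed
  have bound: "(\<Sum>i\<in>{1..n}. f (d n i)) / real n
      \<le> B * real K ^ 6 * ((\<Sum>i\<in>{1..n}. g (d n i)) / real n) + B / real K * (deg_moment n (d n) 7 / real n)" for n
  proof -
    have "(\<Sum>i\<in>{1..n}. f (d n i)) \<le> (\<Sum>i\<in>{1..n}. B * real K ^ 6 * g (d n i) + B / real K * real (d n i) ^ 7)"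
      using d by (intro sum_mono pointwise) auto
    also have "\<dots> = B * real K ^ 6 * (\<Sum>i\<in>{1..n}. g (d n i)) + B / real K * deg_moment n (d n) 7"
      by (simp add: deg_moment_def sum.distrib sum_distrib_left)
    finally have "(\<Sum>i\<in>{1..n}. f (d n i)) / real n \<le>
        (B * real K ^ 6 * (\<Sum>i\<in>{1..n}. g (d n i)) + B / real K * deg_moment n (d n) 7) / real n"
      by (rule divide_right_mono) simp
    then show ?thesis by (simp add: add_divide_distrib)
  qed
  have "(\<lambda>n. B * real K ^ 6 * ((\<Sum>i\<in>{1..n}. g (d n i)) / real n) + B / real K * (deg_moment n (d n) 7 / real n))
      \<longlonglongrightarrow> B * real K ^ 6 * 0 + B / real K * c"
    by (intro tendsto_intros lim_g lim_7)
  moreover have "B * real K ^ 6 * 0 + B / real K * c < a"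
  proof -
    have "B * c \<le> 2 * B * (c + 1)" using B c by (simp add: mult_left_mono algebra_simps)
    also have "\<dots> < a * real K" using K a by (simp add: field_simps)
    finally show ?thesis using K0 by (simp add: field_simps)
  qed
  ultimately have "\<forall>\<^sub>F n in sequentially. B * real K ^ 6 * ((\<Sum>i\<in>{1..n}. g (d n i)) / real n)
      + B / real K * (deg_moment n (d n) 7 / real n) < a"
    by (rule order_tendstoD(2))
  then show "\<forall>\<^sub>F n in sequentially. (\<Sum>i\<in>{1..n}. f (d n i)) / real n < a"
    by eventually_elim (use bound in \<open>meson le_less_trans\<close>)
qed

text \<open>If \<open>D\<close> and \<open>D'\<close> are independent with the limiting degree distribution, then the second factor
  of \<open>zeta\<close> is half the expectation of \<open>(D - D')\<^sup>2 (D + D' - 3)\<close>, because these two pair sums hold for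
  the empirical distribution.\<close>

lemma sum_pairs_square_diff:
  "(\<Sum>i\<in>{1..n}. \<Sum>j\<in>{1..n}. (real (d i) - real (d j))\<^sup>2)
     = 2 * (real n * deg_moment n d 2 - deg_moment n d 1 ^ 2)"
proof -
  have "(\<Sum>i\<in>{1..n}. \<Sum>j\<in>{1..n}. (real (d i) - real (d j))\<^sup>2)
     = (\<Sum>i\<in>{1..n}. \<Sum>j\<in>{1..n}. real (d i) ^ 2 * real (d j) ^ 0 + real (d i) ^ 0 * real (d j) ^ 2
         - 2 * (real (d i) ^ 1 * real (d j) ^ 1))"
    by (intro sum.cong refl) (simp add: power2_eq_square algebra_simps)
  also have "\<dots> = deg_moment n d 2 * deg_moment n d 0 + deg_moment n d 0 * deg_moment n d 2
      - 2 * (deg_moment n d 1 * deg_moment n d 1)"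
    by (simp only: sum.distrib sum_subtractf sum_distrib_left[symmetric] sum_distrib_right[symmetric] deg_moment_def)
  finally show ?thesis by (simp add: deg_moment_def[of n d 0] power2_eq_square)
qed

lemma sum_pairs_weighted_square_diff:
  "(\<Sum>i\<in>{1..n}. \<Sum>j\<in>{1..n}. (real (d i) - real (d j))\<^sup>2 * (real (d i) + real (d j) - 3))
     = 2 * (real n * deg_moment n d 3 - deg_moment n d 1 * deg_moment n d 2
         - 3 * (real n * deg_moment n d 2 - deg_moment n d 1 ^ 2))"
proof -
  have *: "(x - y)\<^sup>2 * (x + y - 3) = x ^ 3 * y ^ 0 + x ^ 0 * y ^ 3 - x ^ 2 * y ^ 1 - x ^ 1 * y ^ 2
         - 3 * (x ^ 2 * y ^ 0 + x ^ 0 * y ^ 2 - 2 * (x ^ 1 * y ^ 1))" for x y :: real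
    by algebra
  show ?thesis
    unfolding *
    by (simp only: sum.distrib sum_subtractf sum_distrib_left[symmetric] sum_distrib_right[symmetric]
        deg_moment_def[symmetric])
      (simp add: deg_moment_def[of n d 0] power2_eq_square)
qed

lemma weighted_square_diff_nonneg:
  fixes x y :: nat
  assumes "1 \<le> x" "1 \<le> y"
  shows "0 \<le> (real x - real y)\<^sup>2 * (real x + real y - 3)"
proof (cases "x = y")
  case False
  then have "3 \<le> x + y" using assms by linarith
  then have "3 \<le> real x + real y" by linarith
  then show ?thesis by simp
qed simp

text \<open>Pairs of different degrees other than \<open>{1, 2}\<close> have weight at least one. For the pair \<open>{1, 2}\<close> the
  weight vanishes, but a third degree \<open>z > 2\<close> differs from both, which pays for it.\<close>

lemma square_diff_le_weighted:
  fixes x y z :: nat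
  assumes "1 \<le> x" "1 \<le> y" "1 \<le> z"
  shows "of_bool (2 < z) * (real x - real y)\<^sup>2
    \<le> (real x - real y)\<^sup>2 * (real x + real y - 3) + (real x - real z)\<^sup>2 * (real x + real z - 3)"
proof (cases "2 < z \<and> x \<noteq> y")
  case False
  then show ?thesis
    using add_nonneg_nonneg[OF weighted_square_diff_nonneg[OF assms(1,2)] weighted_square_diff_nonneg[OF assms(1,3)]]
    by auto
next
  case z: True
  show ?thesis
  proof (cases "4 \<le> x + y")
    case True
    then have "1 \<le> real x + real y - 3" by linarith
    then have "(real x - real y)\<^sup>2 * 1 \<le> (real x - real y)\<^sup>2 * (real x + real y - 3)"
      by (intro mult_left_mono) auto
    from add_mono[OF this weighted_square_diff_nonneg[OF assms(1,3)]] show ?thesis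
      using z by (simp only: of_bool_eq mult_1 mult_1_right add_0_right)
  next
    case False
    then have xy: "x = 1 \<and> y = 2 \<or> x = 2 \<and> y = 1" using z assms by linarith
    have z3: "3 \<le> z" using z by simp
    then have "1 \<le> real z - real x" "1 \<le> real x + real z - 3" using xy by auto
    then have "1 * 1 \<le> (real z - real x)\<^sup>2 * (real x + real z - 3)"
      by (intro mult_mono) (auto intro: one_le_power)
    then have "1 \<le> (real x - real z)\<^sup>2 * (real x + real z - 3)"
      by (simp add: power2_commute)
    then show ?thesis using xy z by auto
  qed
qed

text \<open>The triple inequality summed over all triples: if the weighted pair mean tends to zero, then
  either the variance or the proportion of degrees above two does.\<close>

lemma count_times_variance_le:
  assumes "\<And>i. i \<in> {1..n} \<Longrightarrow> 1 \<le> d i"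
  shows "real (card {i\<in>{1..n}. 2 < d i}) * (real n * deg_moment n d 2 - deg_moment n d 1 ^ 2)
    \<le> 2 * real n * (real n * deg_moment n d 3 - deg_moment n d 1 * deg_moment n d 2
         - 3 * (real n * deg_moment n d 2 - deg_moment n d 1 ^ 2))"
proof -
  let ?V = "\<lambda>i j. (real (d i) - real (d j))\<^sup>2"
  let ?G = "\<lambda>i j. (real (d i) - real (d j))\<^sup>2 * (real (d i) + real (d j) - 3)"
  have "real (card {i\<in>{1..n}. 2 < d i}) * (\<Sum>i\<in>{1..n}. \<Sum>j\<in>{1..n}. ?V i j)
      = (\<Sum>l\<in>{1..n}. of_bool (2 < d l)) * (\<Sum>i\<in>{1..n}. \<Sum>j\<in>{1..n}. ?V i j)"
    by (simp add: Int_def)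
  also have "\<dots> = (\<Sum>l\<in>{1..n}. \<Sum>i\<in>{1..n}. \<Sum>j\<in>{1..n}. of_bool (2 < d l) * ?V i j)"
    by (simp only: sum_distrib_right) (simp only: sum_distrib_left)
  also have "\<dots> \<le> (\<Sum>l\<in>{1..n}. \<Sum>i\<in>{1..n}. \<Sum>j\<in>{1..n}. ?G i j + ?G i l)"
    by (intro sum_mono square_diff_le_weighted assms)
  also have "\<dots> = real n * (\<Sum>i\<in>{1..n}. \<Sum>j\<in>{1..n}. ?G i j) + real n * (\<Sum>l\<in>{1..n}. \<Sum>i\<in>{1..n}. ?G i l)"
    by (simp add: sum.distrib sum_distrib_left)
  also have "(\<Sum>l\<in>{1..n}. \<Sum>i\<in>{1..n}. ?G i l) = (\<Sum>i\<in>{1..n}. \<Sum>l\<in>{1..n}. ?G i l)"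
    by (rule sum.swap)
  finally show ?thesis
    unfolding sum_pairs_square_diff sum_pairs_weighted_square_diff by (simp add: algebra_simps)
qed

lemma weighted_pairs_nonneg:
  assumes "\<And>i. i \<in> {1..n} \<Longrightarrow> 1 \<le> d i"
  shows "0 \<le> real n * deg_moment n d 3 - deg_moment n d 1 * deg_moment n d 2
         - 3 * (real n * deg_moment n d 2 - deg_moment n d 1 ^ 2)"
proof -
  have "0 \<le> (\<Sum>i\<in>{1..n}. \<Sum>j\<in>{1..n}. (real (d i) - real (d j))\<^sup>2 * (real (d i) + real (d j) - 3))"
    by (intro sum_nonneg weighted_square_diff_nonneg assms)
  then show ?thesis unfolding sum_pairs_weighted_square_diff by simp
qed

locale converging_degrees =
  fixes d :: "nat \<Rightarrow> nat \<Rightarrow> nat" and c :: "nat \<Rightarrow> real"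
  assumes deg_seq: "\<And>n. 1 \<le> n \<Longrightarrow> degree_sequence n (d n)"
    and moments: "\<And>k. k \<in> {1..7} \<Longrightarrow> (\<lambda>n. deg_moment n (d n) k / real n) \<longlonglongrightarrow> c k"
    and c_pos: "\<And>k. k \<in> {1..7} \<Longrightarrow> 0 < c k"
begin

lemma degree_ge_1: "i \<in> {1..n} \<Longrightarrow> 1 \<le> d n i"
  using deg_seq[of n] by (auto simp: degree_sequence_def)

lemma moments_numeral:
  "(\<lambda>n. deg_moment n (d n) 1 / real n) \<longlonglongrightarrow> c 1" "(\<lambda>n. deg_moment n (d n) 2 / real n) \<longlonglongrightarrow> c 2"
  "(\<lambda>n. deg_moment n (d n) 3 / real n) \<longlonglongrightarrow> c 3" "(\<lambda>n. deg_moment n (d n) 4 / real n) \<longlonglongrightarrow> c 4"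
  "(\<lambda>n. deg_moment n (d n) 5 / real n) \<longlonglongrightarrow> c 5" "(\<lambda>n. deg_moment n (d n) 6 / real n) \<longlonglongrightarrow> c 6"
  "(\<lambda>n. deg_moment n (d n) 7 / real n) \<longlonglongrightarrow> c 7"
  by (rule moments; simp)+

lemma c1_pos: "0 < c 1" by (rule c_pos) simp

lemma moment_1_ge: "real n \<le> deg_moment n (d n) 1"
proof -
  have "(\<Sum>i\<in>{1..n}. 1) \<le> (\<Sum>i\<in>{1..n}. real (d n i))"
    using degree_ge_1 by (intro sum_mono) force
  then show ?thesis by (simp add: deg_moment_def)
qed

lemma variance_tendsto:
  "(\<lambda>n. (real n * deg_moment n (d n) 2 - deg_moment n (d n) 1 ^ 2) / real n ^ 2) \<longlonglongrightarrow> c 2 - c 1 ^ 2"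
proof -
  have "(\<lambda>n. deg_moment n (d n) 2 / real n - (deg_moment n (d n) 1 / real n) ^ 2) \<longlonglongrightarrow> c 2 - c 1 ^ 2"
    by (intro tendsto_intros moments_numeral)
  then show ?thesis
    by (rule Lim_transform_eventually)
      (auto intro!: eventually_sequentiallyI[of 1] simp: field_simps power2_eq_square)
qed

text \<open>The second factor of \<open>zeta\<close> for the empirical distribution, multiplied by \<open>n\<^sup>2\<close>.\<close>

definition weighted_variance :: "nat \<Rightarrow> real" where
  "weighted_variance n = real n * deg_moment n (d n) 3 - deg_moment n (d n) 1 * deg_moment n (d n) 2
         - 3 * (real n * deg_moment n (d n) 2 - deg_moment n (d n) 1 ^ 2)"

lemma weighted_variance_tendsto:
  "(\<lambda>n. weighted_variance n / real n ^ 2) \<longlonglongrightarrow> (c 3 - c 1 * c 2) - 3 * (c 2 - c 1 ^ 2)"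
proof -
  have "(\<lambda>n. (deg_moment n (d n) 3 / real n
      - deg_moment n (d n) 1 / real n * (deg_moment n (d n) 2 / real n))
      - 3 * ((real n * deg_moment n (d n) 2 - deg_moment n (d n) 1 ^ 2) / real n ^ 2))
    \<longlonglongrightarrow> (c 3 - c 1 * c 2) - 3 * (c 2 - c 1 ^ 2)"
    by (intro tendsto_intros moments_numeral variance_tendsto)
  then show ?thesis
    by (rule Lim_transform_eventually)
      (auto intro!: eventually_sequentiallyI[of 1] simp: field_simps power2_eq_square weighted_variance_def)
qed

lemma weighted_variance_limit_nonneg: "0 \<le> (c 3 - c 1 * c 2) - 3 * (c 2 - c 1 ^ 2)"
  using weighted_variance_tendsto
  by (rule LIMSEQ_le_const)
    (use weighted_pairs_nonneg degree_ge_1 in \<open>auto simp: weighted_variance_def\<close>)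

lemma zeta_nonneg: "0 \<le> zeta (c 1) (c 2) (c 3)"
  unfolding zeta_def using weighted_variance_limit_nonneg c1_pos
  by (intro mult_nonneg_nonneg divide_nonneg_pos) auto

lemma weighted_variance_0_imp:
  assumes "(c 3 - c 1 * c 2) - 3 * (c 2 - c 1 ^ 2) = 0" "c 2 \<noteq> c 1 ^ 2"
  shows "degrees_mostly_le_2 d"
proof -
  let ?p = "\<lambda>n. real (card {i\<in>{1..n}. d n i > 2}) / real n"
  let ?V = "\<lambda>n. (real n * deg_moment n (d n) 2 - deg_moment n (d n) 1 ^ 2) / real n ^ 2"
  have V0: "0 \<le> real n * deg_moment n (d n) 2 - deg_moment n (d n) 1 ^ 2" for n
  proof -
    have "0 \<le> (\<Sum>i\<in>{1..n}. \<Sum>j\<in>{1..n}. (real (d n i) - real (d n j))\<^sup>2)"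
      by (intro sum_nonneg) simp
    then show ?thesis unfolding sum_pairs_square_diff by simp
  qed
  have "(\<lambda>n. ?p n * ?V n) \<longlonglongrightarrow> 0"
  proof (rule tendsto_sandwich[of "\<lambda>n. 0"])
    show "(\<lambda>n. 2 * (weighted_variance n / real n ^ 2)) \<longlonglongrightarrow> 0"
      by (rule tendsto_mult_right_zero) (use weighted_variance_tendsto in \<open>simp only: assms(1)\<close>)
    show "\<forall>\<^sub>F n in sequentially. ?p n * ?V n \<le> 2 * (weighted_variance n / real n ^ 2)"
    proof (rule eventually_sequentiallyI[of 1])
      fix n :: nat assume n: "1 \<le> n"
      have "real (card {i\<in>{1..n}. d n i > 2}) * (real n * deg_moment n (d n) 2 - deg_moment n (d n) 1 ^ 2)
          \<le> 2 * real n * weighted_variance n"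
        unfolding weighted_variance_def by (rule count_times_variance_le) (rule degree_ge_1)
      then have "real (card {i\<in>{1..n}. d n i > 2}) * (real n * deg_moment n (d n) 2 - deg_moment n (d n) 1 ^ 2)
          / real n ^ 3 \<le> 2 * real n * weighted_variance n / real n ^ 3"
        by (rule divide_right_mono) simp
      then show "?p n * ?V n \<le> 2 * (weighted_variance n / real n ^ 2)"
        using n by (simp add: power3_eq_cube power2_eq_square)
    qed
    show "\<forall>\<^sub>F n in sequentially. 0 \<le> ?p n * ?V n"
      using V0 by (intro always_eventually allI mult_nonneg_nonneg divide_nonneg_nonneg) auto
  qed simp
  from tendsto_divide[OF this variance_tendsto] assms(2)
  have lim: "(\<lambda>n. ?p n * ?V n / ?V n) \<longlonglongrightarrow> 0" by simp
  have "\<forall>\<^sub>F n in sequentially. ?V n \<noteq> 0"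
    using variance_tendsto by (rule tendsto_imp_eventually_ne) (use assms(2) in simp)
  then have "\<forall>\<^sub>F n in sequentially. ?p n * ?V n / ?V n = ?p n"
    by eventually_elim (rule nonzero_mult_div_cancel_right)
  with lim show ?thesis
    unfolding degrees_mostly_le_2_def by (rule Lim_transform_eventually)
qed

text \<open>The means of \<open>(D - 1) (D - 2)\<close> and \<open>(D - 1) (D - 2) D\<close> vanish in the limit by truncation, so
  \<open>c 2\<close> and \<open>c 3\<close> are affine functions of \<open>c 1\<close>.\<close>

lemma degrees_mostly_le_2_imp:
  assumes "degrees_mostly_le_2 d"
  shows "(c 3 - c 1 * c 2) - 3 * (c 2 - c 1 ^ 2) = 0"
proof -
  have lim0: "(\<lambda>n. (\<Sum>i\<in>{1..n}. of_bool (2 < d n i)) / real n) \<longlonglongrightarrow> 0"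
    using assms by (simp add: degrees_mostly_le_2_def Int_def)
  have vanish: "(\<lambda>n. (\<Sum>i\<in>{1..n}. (real (d n i) - 1) * (real (d n i) - 2) * real (d n i) ^ j) / real n) \<longlonglongrightarrow> 0"
    if j: "j \<le> 1" for j
  proof (rule mean_tendsto_0_by_truncation[OF degree_ge_1 _ _ _ _ lim0 moments_numeral(7),
        where B = 1 and f = "\<lambda>x. (real x - 1) * (real x - 2) * real x ^ j"])
    fix x :: nat assume x: "1 \<le> x"
    have "0 \<le> (real x - 1) * (real x - 2)" using x by (cases "x = 1") auto
    then show "0 \<le> (real x - 1) * (real x - 2) * real x ^ j" by simp
    have "(real x - 1) * (real x - 2) \<le> real x ^ 2"
      using x by (simp add: power2_eq_square algebra_simps)
    then have "(real x - 1) * (real x - 2) * real x ^ j \<le> real x ^ 2 * real x ^ j"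
      by (rule mult_right_mono) simp
    also have "\<dots> \<le> real x ^ 6"
      unfolding power_add[symmetric] using x j by (intro power_increasing) auto
    finally show "(real x - 1) * (real x - 2) * real x ^ j \<le> 1 * real x ^ 6" by simp
    show "(1 :: real) \<le> of_bool (2 < x)" if "(real x - 1) * (real x - 2) * real x ^ j \<noteq> 0"
    proof -
      have "x \<noteq> 1" "x \<noteq> 2" using that by auto
      then show ?thesis using x by simp
    qed
  qed (simp_all add: of_bool_def)
  have c2: "c 2 - 3 * c 1 + 2 = 0"
  proof (rule LIMSEQ_unique[OF _ vanish[of 0]])
    have "(\<lambda>n. deg_moment n (d n) 2 / real n - 3 * (deg_moment n (d n) 1 / real n) + 2)
        \<longlonglongrightarrow> c 2 - 3 * c 1 + 2"
      by (intro tendsto_intros moments_numeral)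
    moreover have "deg_moment n (d n) 2 / real n - 3 * (deg_moment n (d n) 1 / real n) + 2
        = (\<Sum>i\<in>{1..n}. (real (d n i) - 1) * (real (d n i) - 2) * real (d n i) ^ 0) / real n"
      if n: "1 \<le> n" for n
    proof -
      have "(\<Sum>i\<in>{1..n}. (real (d n i) - 1) * (real (d n i) - 2) * real (d n i) ^ 0)
          = (\<Sum>i\<in>{1..n}. real (d n i) ^ 2 - 3 * real (d n i) + 2)"
        by (intro sum.cong refl) (simp add: power2_eq_square algebra_simps)
      also have "\<dots> = deg_moment n (d n) 2 - 3 * deg_moment n (d n) 1 + 2 * real n"
        by (simp add: deg_moment_def sum.distrib sum_subtractf sum_distrib_left)
      finally show ?thesis using n by (simp add: add_divide_distrib diff_divide_distrib)
    qed
    ultimately show "(\<lambda>n. (\<Sum>i\<in>{1..n}. (real (d n i) - 1) * (real (d n i) - 2) * real (d n i) ^ 0) / real n)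
        \<longlonglongrightarrow> c 2 - 3 * c 1 + 2"
      by (elim Lim_transform_eventually) (auto intro!: eventually_sequentiallyI[of 1])
  qed simp
  have c3: "c 3 - 3 * c 2 + 2 * c 1 = 0"
  proof (rule LIMSEQ_unique[OF _ vanish[of 1]])
    have "(\<lambda>n. deg_moment n (d n) 3 / real n - 3 * (deg_moment n (d n) 2 / real n)
        + 2 * (deg_moment n (d n) 1 / real n)) \<longlonglongrightarrow> c 3 - 3 * c 2 + 2 * c 1"
      by (intro tendsto_intros moments_numeral)
    moreover have "deg_moment n (d n) 3 / real n - 3 * (deg_moment n (d n) 2 / real n)
        + 2 * (deg_moment n (d n) 1 / real n)
        = (\<Sum>i\<in>{1..n}. (real (d n i) - 1) * (real (d n i) - 2) * real (d n i) ^ 1) / real n" for n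
    proof -
      have "(\<Sum>i\<in>{1..n}. (real (d n i) - 1) * (real (d n i) - 2) * real (d n i) ^ 1)
          = (\<Sum>i\<in>{1..n}. real (d n i) ^ 3 - 3 * real (d n i) ^ 2 + 2 * real (d n i))"
        by (intro sum.cong refl) (simp add: power2_eq_square power3_eq_cube algebra_simps)
      also have "\<dots> = deg_moment n (d n) 3 - 3 * deg_moment n (d n) 2 + 2 * deg_moment n (d n) 1"
        by (simp add: deg_moment_def sum.distrib sum_subtractf sum_distrib_left)
      finally show ?thesis by (simp add: add_divide_distrib diff_divide_distrib)
    qed
    ultimately show "(\<lambda>n. (\<Sum>i\<in>{1..n}. (real (d n i) - 1) * (real (d n i) - 2) * real (d n i) ^ 1) / real n)
        \<longlonglongrightarrow> c 3 - 3 * c 2 + 2 * c 1"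
      by simp
  qed simp
  from c2 have "c 2 = 3 * c 1 - 2" by simp
  moreover from this c3 have "c 3 = 7 * c 1 - 6" by simp
  ultimately show ?thesis by algebra
qed

text \<open>A degree \<open>x\<close> above two has \<open>x\<^sup>2 - x \<ge> 1\<close>, and no degree has \<open>x\<^sup>2 - x < 0\<close>.\<close>

lemma c2_eq_c1_imp_mostly_le_2:
  assumes "c 2 = c 1"
  shows "degrees_mostly_le_2 d"
  unfolding degrees_mostly_le_2_def
proof (rule tendsto_sandwich[of "\<lambda>n. 0"])
  have "(\<lambda>n. deg_moment n (d n) 2 / real n - deg_moment n (d n) 1 / real n) \<longlonglongrightarrow> c 2 - c 1"
    by (intro tendsto_intros moments_numeral)
  then show "(\<lambda>n. deg_moment n (d n) 2 / real n - deg_moment n (d n) 1 / real n) \<longlonglongrightarrow> 0"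
    using assms by simp
  show "\<forall>\<^sub>F n in sequentially. real (card {i\<in>{1..n}. d n i > 2}) / real n
      \<le> deg_moment n (d n) 2 / real n - deg_moment n (d n) 1 / real n"
  proof (intro always_eventually allI)
    fix n
    have "real (card {i\<in>{1..n}. d n i > 2}) = (\<Sum>i\<in>{1..n}. of_bool (d n i > 2))"
      by (simp add: Int_def)
    also have "\<dots> \<le> (\<Sum>i\<in>{1..n}. real (d n i) ^ 2 - real (d n i) ^ 1)"
    proof (rule sum_mono)
      fix i assume i: "i \<in> {1..n}"
      have "1 \<le> real (d n i)" using degree_ge_1[OF i] by simp
      then have "0 \<le> real (d n i) * (real (d n i) - 1)" by simp
      moreover have "1 * 1 \<le> real (d n i) * (real (d n i) - 1)" if "2 < d n i"
        using that by (intro mult_mono) auto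
      ultimately show "of_bool (d n i > 2) \<le> real (d n i) ^ 2 - real (d n i) ^ 1"
        by (auto simp: power2_eq_square algebra_simps)
    qed
    also have "\<dots> = deg_moment n (d n) 2 - deg_moment n (d n) 1"
      by (simp add: deg_moment_def sum_subtractf)
    finally show "real (card {i\<in>{1..n}. d n i > 2}) / real n
      \<le> deg_moment n (d n) 2 / real n - deg_moment n (d n) 1 / real n"
      unfolding diff_divide_distrib[symmetric] by (rule divide_right_mono) simp
  qed
qed auto

text \<open>A vanishing variance forces the mean to be an integer \<open>r\<close>, since the distance of any degree to the
  mean is at least the distance of the mean to its nearest integer. The higher moments follow by
  truncation, as \<open>(x - r)\<^sup>2 \<ge> 1\<close> for integers \<open>x \<noteq> r\<close>.\<close>

lemma variance_0_imp_moments: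
  assumes "c 2 = c 1 ^ 2"
  shows "\<exists>r::nat. \<forall>k\<in>{1..6}. c k = real r ^ k"
proof -
  have lim: "(\<lambda>n. (\<Sum>i\<in>{1..n}. (real (d n i) - c 1)\<^sup>2) / real n) \<longlonglongrightarrow> 0"
  proof -
    have "(\<lambda>n. deg_moment n (d n) 2 / real n - 2 * c 1 * (deg_moment n (d n) 1 / real n) + c 1 ^ 2)
        \<longlonglongrightarrow> c 2 - 2 * c 1 * c 1 + c 1 ^ 2"
      by (intro tendsto_intros moments_numeral)
    moreover have "deg_moment n (d n) 2 / real n - 2 * c 1 * (deg_moment n (d n) 1 / real n) + c 1 ^ 2
        = (\<Sum>i\<in>{1..n}. (real (d n i) - c 1)\<^sup>2) / real n" if "1 \<le> n" for n
    proof -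
      have "(\<Sum>i\<in>{1..n}. (real (d n i) - c 1)\<^sup>2)
          = (\<Sum>i\<in>{1..n}. real (d n i) ^ 2 - 2 * c 1 * real (d n i) + c 1 ^ 2)"
        by (intro sum.cong refl) (simp add: power2_diff)
      also have "\<dots> = deg_moment n (d n) 2 - 2 * c 1 * deg_moment n (d n) 1 + c 1 ^ 2 * real n"
        by (simp add: deg_moment_def sum.distrib sum_subtractf sum_distrib_left)
      finally show ?thesis using that by (simp add: add_divide_distrib diff_divide_distrib)
    qed
    ultimately have "(\<lambda>n. (\<Sum>i\<in>{1..n}. (real (d n i) - c 1)\<^sup>2) / real n) \<longlonglongrightarrow> c 2 - 2 * c 1 * c 1 + c 1 ^ 2"
      by (elim Lim_transform_eventually) (auto intro!: eventually_sequentiallyI[of 1])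
    then show ?thesis using assms by (simp add: power2_eq_square)
  qed
  have "\<bar>c 1 - of_int (round (c 1))\<bar>\<^sup>2 \<le> 0"
  proof (rule LIMSEQ_le_const[OF lim])
    have "\<bar>c 1 - of_int (round (c 1))\<bar>\<^sup>2 \<le> (\<Sum>i\<in>{1..n}. (real (d n i) - c 1)\<^sup>2) / real n" if n: "1 \<le> n" for n
    proof -
      have "\<bar>c 1 - of_int (round (c 1))\<bar>\<^sup>2 \<le> (real x - c 1)\<^sup>2" for x :: nat
      proof -
        have "\<bar>c 1 - of_int (round (c 1))\<bar> \<le> \<bar>c 1 - of_int (int x)\<bar>" by (rule round_diff_minimal)
        then have "\<bar>c 1 - of_int (round (c 1))\<bar>\<^sup>2 \<le> \<bar>c 1 - of_int (int x)\<bar>\<^sup>2"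
          by (rule power_mono) simp
        then show ?thesis by (simp add: power2_commute)
      qed
      then have "(\<Sum>i\<in>{1..n}. \<bar>c 1 - of_int (round (c 1))\<bar>\<^sup>2) \<le> (\<Sum>i\<in>{1..n}. (real (d n i) - c 1)\<^sup>2)"
        by (intro sum_mono)
      then show ?thesis using n by (simp add: field_simps)
    qed
    then show "\<exists>N. \<forall>n\<ge>N. \<bar>c 1 - of_int (round (c 1))\<bar>\<^sup>2 \<le> (\<Sum>i\<in>{1..n}. (real (d n i) - c 1)\<^sup>2) / real n"
      by blast
  qed
  then have "c 1 = of_int (round (c 1))" by simp
  define r where "r = nat (round (c 1))"
  have r: "c 1 = real r"
    using \<open>c 1 = of_int (round (c 1))\<close> c1_pos unfolding r_def
    by (metis less_eq_real_def of_int_0_le_iff of_nat_nat)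
  have "c k = real r ^ k" if k: "k \<in> {1..6}" for k
  proof -
    have "(\<lambda>n. (\<Sum>i\<in>{1..n}. \<bar>real (d n i) ^ k - real r ^ k\<bar>) / real n) \<longlonglongrightarrow> 0"
    proof (rule mean_tendsto_0_by_truncation[OF degree_ge_1 _ _ _ _ _ moments_numeral(7),
          where B = "1 + real r ^ k" and f = "\<lambda>x. \<bar>real x ^ k - real r ^ k\<bar>" and g = "\<lambda>x. (real x - real r)\<^sup>2"])
      show "(\<lambda>n. (\<Sum>i\<in>{1..n}. (real (d n i) - real r)\<^sup>2) / real n) \<longlonglongrightarrow> 0"
        using lim unfolding r .
    next
      fix x :: nat assume x: "1 \<le> x"
      have "real x ^ k \<le> real x ^ 6" "1 \<le> real x ^ 6"
        using x k by (auto intro!: power_increasing one_le_power)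
      then have "real x ^ k + real r ^ k * 1 \<le> real x ^ 6 + real r ^ k * real x ^ 6"
        by (intro add_mono mult_left_mono) auto
      moreover have "\<bar>real x ^ k - real r ^ k\<bar> \<le> real x ^ k + real r ^ k"
        by (rule order_trans[OF abs_triangle_ineq4]) simp
      ultimately show "\<bar>real x ^ k - real r ^ k\<bar> \<le> (1 + real r ^ k) * real x ^ 6"
        by (simp add: algebra_simps)
      show "1 \<le> (real x - real r)\<^sup>2" if "\<bar>real x ^ k - real r ^ k\<bar> \<noteq> 0"
      proof -
        have "x \<noteq> r" using that by auto
        then have "1 \<le> \<bar>real x - real r\<bar>" by linarith
        then have "1 ^ 2 \<le> \<bar>real x - real r\<bar> ^ 2" by (rule power_mono) simp
        then show ?thesis by simp
      qed
    qed auto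
    then have "(\<lambda>n. deg_moment n (d n) k / real n - real r ^ k) \<longlonglongrightarrow> 0"
    proof (rule Lim_null_comparison[rotated])
      have "norm (deg_moment n (d n) k / real n - real r ^ k)
          \<le> (\<Sum>i\<in>{1..n}. \<bar>real (d n i) ^ k - real r ^ k\<bar>) / real n" if n: "1 \<le> n" for n
      proof -
        have "deg_moment n (d n) k / real n - real r ^ k = (\<Sum>i\<in>{1..n}. real (d n i) ^ k - real r ^ k) / real n"
          using n by (simp add: deg_moment_def sum_subtractf diff_divide_distrib)
        then have "norm (deg_moment n (d n) k / real n - real r ^ k)
            = \<bar>\<Sum>i\<in>{1..n}. real (d n i) ^ k - real r ^ k\<bar> / real n" by simp
        also have "\<dots> \<le> (\<Sum>i\<in>{1..n}. \<bar>real (d n i) ^ k - real r ^ k\<bar>) / real n"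
          by (intro divide_right_mono sum_abs) simp
        finally show ?thesis .
      qed
      then show "\<forall>\<^sub>F n in sequentially. norm (deg_moment n (d n) k / real n - real r ^ k)
          \<le> (\<Sum>i\<in>{1..n}. \<bar>real (d n i) ^ k - real r ^ k\<bar>) / real n"
        by (intro eventually_sequentiallyI[of 1])
    qed
    moreover have "(\<lambda>n. deg_moment n (d n) k / real n - real r ^ k) \<longlonglongrightarrow> c k - real r ^ k"
      using k by (intro tendsto_intros moments) auto
    ultimately show ?thesis using LIMSEQ_unique by fastforce
  qed
  then show ?thesis by blast
qed

lemma variance_0_iff: "c 2 = c 1 ^ 2 \<longleftrightarrow> (\<exists>r::nat. \<forall>k\<in>{1..6}. c k = real r ^ k)"
proof
  assume "\<exists>r::nat. \<forall>k\<in>{1..6}. c k = real r ^ k"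
  then obtain r :: nat where "\<forall>k\<in>{1..6}. c k = real r ^ k" by blast
  then have "c 1 = real r ^ 1" "c 2 = real r ^ 2" by auto
  then show "c 2 = c 1 ^ 2" by simp
qed (rule variance_0_imp_moments)

lemma zeta_eq_0_iff: "zeta (c 1) (c 2) (c 3) = 0 \<longleftrightarrow> c 2 = c 1 ^ 2 \<or> degrees_mostly_le_2 d"
proof
  assume "zeta (c 1) (c 2) (c 3) = 0"
  then have "c 2 = c 1 \<or> (c 3 - c 1 * c 2) - 3 * (c 2 - c 1 ^ 2) = 0"
    using c1_pos by (auto simp: zeta_def)
  then show "c 2 = c 1 ^ 2 \<or> degrees_mostly_le_2 d"
    using c2_eq_c1_imp_mostly_le_2 weighted_variance_0_imp by blast
next
  assume "c 2 = c 1 ^ 2 \<or> degrees_mostly_le_2 d"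
  then have "(c 3 - c 1 * c 2) - 3 * (c 2 - c 1 ^ 2) = 0"
  proof
    assume c2: "c 2 = c 1 ^ 2"
    then obtain r :: nat where r: "\<forall>k\<in>{1..6}. c k = real r ^ k" using variance_0_imp_moments by blast
    then have "c 1 = real r" "c 3 = real r ^ 3" by auto
    then show ?thesis using c2 by (simp add: power2_eq_square power3_eq_cube)
  qed (rule degrees_mostly_le_2_imp)
  then show "zeta (c 1) (c 2) (c 3) = 0" by (simp add: zeta_def)
qed

lemma regular_moments:
  assumes "\<forall>n\<ge>1. \<forall>i\<in>{1..n}. d n i = r" "k \<in> {1..7}"
  shows "c k = real r ^ k"
proof (rule LIMSEQ_unique[OF moments[OF assms(2)]])
  have "\<forall>\<^sub>F n in sequentially. real r ^ k = deg_moment n (d n) k / real n"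
    using assms(1) by (intro eventually_sequentiallyI[of 1]) (simp add: deg_moment_def)
  then show "(\<lambda>n. deg_moment n (d n) k / real n) \<longlonglongrightarrow> real r ^ k"
    by (rule Lim_transform_eventually[OF tendsto_const])
qed

text \<open>In the moment formula only the terms of total degree four in the moments and \<open>n\<close> survive
  division by \<open>n\<^sup>4\<close>.\<close>

lemma expectation_bias_tendsto:
  "(\<lambda>n. measure_pmf.expectation (config_model n (d n)) (\<lambda>M. real n * bias n (d n) M))
     \<longlonglongrightarrow> zeta (c 1) (c 2) (c 3)"
proof -
  define a where "a k n = deg_moment n (d n) k / real n" for k n
  define u where "u n = 1 / real n" for n :: nat
  have u: "u \<longlonglongrightarrow> 0" unfolding u_def by (rule lim_1_over_n)
  have a: "a 1 \<longlonglongrightarrow> c 1" "a 2 \<longlonglongrightarrow> c 2" "a 3 \<longlonglongrightarrow> c 3" "a 4 \<longlonglongrightarrow> c 4" "a 5 \<longlonglongrightarrow> c 5" "a 6 \<longlonglongrightarrow> c 6" "a 7 \<longlonglongrightarrow> c 7"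
    unfolding a_def by (rule moments_numeral)+
  define N2 where "N2 = (\<lambda>a :: nat \<Rightarrow> real. 6*a 1*a 3 - 18*a 1*a 4 + 14*a 1*a 5 - 2*a 1*a 6 + 4*a 2*a 3 - 8*a 2*a 4 + 4*a 3^2
    + (2*a 7 - 10*a 6 + 14*a 5 - 6*a 4))"
  define N3 where "N3 = (\<lambda>a :: nat \<Rightarrow> real. - 14*a 1*a 2*a 3 + 3*a 1*a 2*a 4 - 9*a 1^2*a 2 + 18*a 1^2*a 3 - 5*a 1^2*a 4
        + 3*a 1*a 2^2 + 4*a 2^3
    + (6*a 1*a 3 - 8*a 1*a 4 + 2*a 1*a 5 - 13*a 2*a 3 + 11*a 2*a 4 - 2*a 2*a 5 - a 3*a 4
        + 3*a 2^2 + 2*a 3^2))"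
  define N4 where "N4 = (\<lambda>a :: nat \<Rightarrow> real. - 7*a 1^3*a 2 - a 1*a 2^3 + 5*a 1^2*a 2^2 + 3*a 1^4
    + (- 2*a 1*a 2*a 3 - 3*a 1^2*a 2 + a 1^2*a 3 + 6*a 1*a 2^2 + a 2^2*a 3 - 3*a 2^3))"
  have lim: "(\<lambda>n. (u n ^ 2 * N2 (\<lambda>k. a k n) + u n * N3 (\<lambda>k. a k n) + N4 (\<lambda>k. a k n))
      / (2 * (a 1 n - u n) * (a 1 n - 3 * u n) * (a 1 n - 5 * u n) * (a 1 n - 7 * u n)))
    \<longlonglongrightarrow> (0 ^ 2 * N2 c + 0 * N3 c + N4 c)
      / (2 * (c 1 - 0) * (c 1 - 3 * 0) * (c 1 - 5 * 0) * (c 1 - 7 * 0))"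
    unfolding N2_def N3_def N4_def using c1_pos
    by (intro tendsto_intros a u) auto
  have limit: "(0 ^ 2 * N2 c + 0 * N3 c + N4 c)
      / (2 * (c 1 - 0) * (c 1 - 3 * 0) * (c 1 - 5 * 0) * (c 1 - 7 * 0)) = zeta (c 1) (c 2) (c 3)"
  proof -
    have "N4 c = (c 2 - c 1)^2 * ((c 3 - c 1 * c 2) - 3 * (c 2 - c 1^2))"
      unfolding N4_def by algebra
    then show ?thesis by (simp add: zeta_def power4_eq_xxxx mult.assoc)
  qed
  have "(u n ^ 2 * N2 (\<lambda>k. a k n) + u n * N3 (\<lambda>k. a k n) + N4 (\<lambda>k. a k n))
      / (2 * (a 1 n - u n) * (a 1 n - 3 * u n) * (a 1 n - 5 * u n) * (a 1 n - 7 * u n))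
      = measure_pmf.expectation (config_model n (d n)) (\<lambda>M. real n * bias n (d n) M)" if n: "8 \<le> n" for n
  proof -
    define N where "N = real n"
    have N: "N \<noteq> 0" "N * u n = 1" using n by (simp_all add: N_def u_def)
    define b where "b k = a k n" for k
    have m: "deg_moment n (d n) k = N * b k" for k using N(1) by (simp add: b_def a_def N_def)
    have "deg_moment n (d n) 1 > 7" using moment_1_ge[of n] n by linarith
    note E = expectation_bias_moments[OF deg_seq[OF order_trans[OF _ n]] this]
    have num: "(6*(N * b 1)*(N * b 3) - 18*(N * b 1)*(N * b 4) + 14*(N * b 1)*(N * b 5) - 2*(N * b 1)*(N * b 6) + 4*(N * b 2)*(N * b 3) - 8*(N * b 2)*(N * b 4) + 4*(N * b 3)^2
        - 14*(N * b 1)*(N * b 2)*(N * b 3) + 3*(N * b 1)*(N * b 2)*(N * b 4) - 9*(N * b 1)^2*(N * b 2) + 18*(N * b 1)^2*(N * b 3) - 5*(N * b 1)^2*(N * b 4)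
        + 3*(N * b 1)*(N * b 2)^2 + 4*(N * b 2)^3 - 7*(N * b 1)^3*(N * b 2) - (N * b 1)*(N * b 2)^3 + 5*(N * b 1)^2*(N * b 2)^2 + 3*(N * b 1)^4)
       + N * (2*(N * b 7) - 10*(N * b 6) + 14*(N * b 5) - 6*(N * b 4)
        + 6*(N * b 1)*(N * b 3) - 8*(N * b 1)*(N * b 4) + 2*(N * b 1)*(N * b 5) - 13*(N * b 2)*(N * b 3) + 11*(N * b 2)*(N * b 4) - 2*(N * b 2)*(N * b 5) - (N * b 3)*(N * b 4)
        + 3*(N * b 2)^2 + 2*(N * b 3)^2
        - 2*(N * b 1)*(N * b 2)*(N * b 3) - 3*(N * b 1)^2*(N * b 2) + (N * b 1)^2*(N * b 3) + 6*(N * b 1)*(N * b 2)^2 + (N * b 2)^2*(N * b 3) - 3*(N * b 2)^3)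
      = N^2 * N2 b + N^3 * N3 b + N^4 * N4 b"
      unfolding N2_def N3_def N4_def by algebra
    have "N^2 * N2 b + N^3 * N3 b + N^4 * N4 b = N^4 * (u n ^ 2 * N2 b + u n * N3 b + N4 b)"
      using N(2) by algebra
    note num = num[unfolded this]
    have den: "2 * (N * b 1 - 1) * (N * b 1 - 3) * (N * b 1 - 5) * (N * b 1 - 7)
        = N^4 * (2 * (b 1 - u n) * (b 1 - 3 * u n) * (b 1 - 5 * u n) * (b 1 - 7 * u n))"
    proof -
      have "N * b 1 - 1 = N * (b 1 - u n)" "N * b 1 - 3 = N * (b 1 - 3 * u n)"
        "N * b 1 - 5 = N * (b 1 - 5 * u n)" "N * b 1 - 7 = N * (b 1 - 7 * u n)"
        using N(2) by algebra+
      then show ?thesis by (simp add: power4_eq_xxxx mult_ac)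
    qed
    have "measure_pmf.expectation (config_model n (d n)) (\<lambda>M. real n * bias n (d n) M)
        = (u n ^ 2 * N2 b + u n * N3 b + N4 b)
          / (2 * (b 1 - u n) * (b 1 - 3 * u n) * (b 1 - 5 * u n) * (b 1 - 7 * u n))"
      by (subst E) (use n N(1) in \<open>simp_all only: m N_def[symmetric] num den
          mult_divide_mult_cancel_left power_not_zero not_False_eq_True\<close>)
    then show ?thesis unfolding b_def by simp
  qed
  then show ?thesis
    by (intro Lim_transform_eventually[OF lim[unfolded limit]] eventually_sequentiallyI[of 8])
qed

end

section \<open>Triangle-free pairings\<close>

definition all_wedges :: "nat \<Rightarrow> (nat \<Rightarrow> nat) \<Rightarrow> ((nat \<times> nat) \<times> (nat \<times> nat)) set" where
  "all_wedges n d = (\<Union>i\<in>{1..n}. wedges d i)"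

definition labelled_triangles :: "nat \<Rightarrow> (nat \<Rightarrow> nat) \<Rightarrow> (nat \<times> nat) set set set" where
  "labelled_triangles n d = {triangle u v w |u v w i j k.
     (i, j, k) \<in> distinct_triples {1..n} \<and> u \<in> wedges d i \<and> v \<in> wedges d j \<and> w \<in> wedges d k}"

lemma finite_all_wedges [simp]: "finite (all_wedges n d)"
  by (simp add: all_wedges_def)

lemma card_all_wedges_le: "real (card (all_wedges n d)) \<le> deg_moment n d 2"
proof -
  have "real (card (all_wedges n d)) \<le> real (\<Sum>i\<in>{1..n}. card (wedges d i))"
    unfolding all_wedges_def by (intro of_nat_mono card_UN_le) simp
  also have "\<dots> = (\<Sum>i\<in>{1..n}. real (d i) * (real (d i) - 1))" by (simp add: card_wedges)
  also have "\<dots> \<le> deg_moment n d 2"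
    unfolding deg_moment_def by (intro sum_mono) (simp add: power2_eq_square algebra_simps)
  finally show ?thesis .
qed

lemma triangle_rotate: "triangle u v w = triangle v w u"
  by (auto simp: triangle_def)

lemma Union_triangle: "\<Union>(triangle u v w) = {fst u, snd u, fst v, snd v, fst w, snd w}"
  by (auto simp: triangle_def)

lemma labelled_triangles_subset:
  "labelled_triangles n d
    \<subseteq> (\<lambda>(u, v, w). triangle u v w) ` (all_wedges n d \<times> all_wedges n d \<times> all_wedges n d)"
proof
  fix F assume "F \<in> labelled_triangles n d"
  then obtain u v w i j k where uvw: "F = triangle u v w" "(i, j, k) \<in> distinct_triples {1..n}"
    "u \<in> wedges d i" "v \<in> wedges d j" "w \<in> wedges d k"
    by (auto simp: labelled_triangles_def)
  then have "(u, v, w) \<in> all_wedges n d \<times> all_wedges n d \<times> all_wedges n d"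
    by (auto simp: all_wedges_def distinct_triples_def)
  then show "F \<in> (\<lambda>(u, v, w). triangle u v w) ` (all_wedges n d \<times> all_wedges n d \<times> all_wedges n d)"
    by (rule rev_image_eqI) (simp add: uvw(1))
qed

lemma finite_labelled_triangles: "finite (labelled_triangles n d)"
  by (rule finite_subset[OF labelled_triangles_subset]) simp

lemma card_labelled_triangles_le: "real (card (labelled_triangles n d)) \<le> deg_moment n d 2 ^ 3"
proof -
  have "card (labelled_triangles n d) \<le> card (all_wedges n d \<times> all_wedges n d \<times> all_wedges n d)"
    by (rule surj_card_le[OF _ labelled_triangles_subset]) simp
  then have "real (card (labelled_triangles n d)) \<le> real (card (all_wedges n d)) ^ 3"
    by (simp add: card_cartesian_product power3_eq_cube mult.assoc flip: of_nat_mult)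
  also have "\<dots> \<le> deg_moment n d 2 ^ 3" by (intro power_mono card_all_wedges_le) simp
  finally show ?thesis .
qed

lemma labelled_triangles_partial_matching:
  assumes "F \<in> labelled_triangles n d"
  shows "partial_matching (half_edges n d) F" "card F = 3"
  using assms partial_matching_triangle by (auto simp: labelled_triangles_def)

text \<open>By rotation, the triangles through a half-edge \<open>h\<close> may be written with \<open>h\<close> in their first
  wedge, for which there are at most \<open>2 d\<close> choices.\<close>

lemma card_labelled_triangles_through_le:
  assumes h: "h \<in> half_edges n d"
  shows "real (card {F \<in> labelled_triangles n d. h \<in> \<Union>F}) \<le> 2 * real (d (fst h)) * deg_moment n d 2 ^ 2"
proof -
  let ?A = "half_edges_at d (fst h)"
  let ?U = "{h} \<times> ?A \<union> ?A \<times> {h}"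
  let ?W = "all_wedges n d"
  have "{F \<in> labelled_triangles n d. h \<in> \<Union>F} \<subseteq> (\<lambda>(u, v, w). triangle u v w) ` (?U \<times> ?W \<times> ?W)"
  proof
    fix F assume F: "F \<in> {F \<in> labelled_triangles n d. h \<in> \<Union>F}"
    then obtain u v w i j k where uvw: "F = triangle u v w" "(i, j, k) \<in> distinct_triples {1..n}"
      "u \<in> wedges d i" "v \<in> wedges d j" "w \<in> wedges d k"
      by (auto simp: labelled_triangles_def)
    have W: "u \<in> ?W" "v \<in> ?W" "w \<in> ?W"
      using uvw(2-5) by (auto simp: all_wedges_def distinct_triples_def)
    have first: "t \<in> ?U" if "t \<in> ?W" "h = fst t \<or> h = snd t" for t
      using that by (cases t) (auto simp: all_wedges_def mem_wedges)
    have "h = fst u \<or> h = snd u \<or> h = fst v \<or> h = snd v \<or> h = fst w \<or> h = snd w"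
      using F Union_triangle[of u v w] unfolding uvw(1) by blast
    then have "(u, v, w) \<in> ?U \<times> ?W \<times> ?W \<or> (v, w, u) \<in> ?U \<times> ?W \<times> ?W \<or> (w, u, v) \<in> ?U \<times> ?W \<times> ?W"
      using first W by blast
    moreover have "F = triangle v w u" "F = triangle w u v" using uvw(1) triangle_rotate by metis+
    ultimately show "F \<in> (\<lambda>(u, v, w). triangle u v w) ` (?U \<times> ?W \<times> ?W)"
      using uvw(1) by (elim disjE) (erule rev_image_eqI, simp only: prod.case)+
  qed
  then have "card {F \<in> labelled_triangles n d. h \<in> \<Union>F} \<le> card (?U \<times> ?W \<times> ?W)"
    by (intro surj_card_le) auto
  also have "\<dots> = card ?U * (card ?W * card ?W)" by (simp add: card_cartesian_product)
  also have "\<dots> \<le> (2 * d (fst h)) * (card ?W * card ?W)"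
  proof (rule mult_right_mono)
    have "card ?U \<le> card ({h} \<times> ?A) + card (?A \<times> {h})" by (rule card_Un_le)
    then show "card ?U \<le> 2 * d (fst h)" by (simp add: card_cartesian_product)
  qed simp
  finally have "real (card {F \<in> labelled_triangles n d. h \<in> \<Union>F}) \<le> real (2 * d (fst h) * (card ?W * card ?W))"
    by (rule of_nat_mono)
  also have "\<dots> = 2 * real (d (fst h)) * real (card ?W) ^ 2" by (simp add: power2_eq_square)
  also have "\<dots> \<le> 2 * real (d (fst h)) * deg_moment n d 2 ^ 2"
    by (intro mult_left_mono power_mono card_all_wedges_le) auto
  finally show ?thesis .
qed

lemma degree_le_sqrt_moment:
  assumes "i \<in> {1..n}"
  shows "real (d i) \<le> sqrt (deg_moment n d 2)"
proof (rule real_le_rsqrt)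
  show "(real (d i))\<^sup>2 \<le> deg_moment n d 2"
    unfolding deg_moment_def using assms by (intro member_le_sum) auto
qed

lemma card_conflicting_triangles_le:
  assumes F: "F \<in> labelled_triangles n d"
  shows "real (card {B \<in> labelled_triangles n d. conflicting F B})
    \<le> 12 * sqrt (deg_moment n d 2) * deg_moment n d 2 ^ 2"
proof -
  let ?H = "half_edges n d" and ?T = "labelled_triangles n d"
  note pm = labelled_triangles_partial_matching[OF F]
  have UF: "\<Union>F \<subseteq> ?H" "finite (\<Union>F)"
    using pm(1) by (auto simp: partial_matching_def intro: finite_subset[OF _ finite_half_edges])
  have "{B \<in> ?T. conflicting F B} \<subseteq> (\<Union>h\<in>\<Union>F. {B \<in> ?T. h \<in> \<Union>B})"
    by (auto simp: conflicting_def)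
  then have "card {B \<in> ?T. conflicting F B} \<le> card (\<Union>h\<in>\<Union>F. {B \<in> ?T. h \<in> \<Union>B})"
    by (intro card_mono finite_UN_I UF(2)) (simp add: finite_labelled_triangles)
  also have "\<dots> \<le> (\<Sum>h\<in>\<Union>F. card {B \<in> ?T. h \<in> \<Union>B})"
    by (rule card_UN_le[OF UF(2)])
  finally have "real (card {B \<in> ?T. conflicting F B}) \<le> (\<Sum>h\<in>\<Union>F. real (card {B \<in> ?T. h \<in> \<Union>B}))"
    by (simp flip: of_nat_sum)
  also have "\<dots> \<le> (\<Sum>h\<in>\<Union>F. 2 * sqrt (deg_moment n d 2) * deg_moment n d 2 ^ 2)"
  proof (rule sum_mono)
    fix h assume "h \<in> \<Union>F"
    then have h: "h \<in> ?H" using UF by blast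
    have "real (card {B \<in> ?T. h \<in> \<Union>B}) \<le> 2 * real (d (fst h)) * deg_moment n d 2 ^ 2"
      by (rule card_labelled_triangles_through_le[OF h])
    also have "\<dots> \<le> 2 * sqrt (deg_moment n d 2) * deg_moment n d 2 ^ 2"
      using h by (intro mult_right_mono mult_left_mono degree_le_sqrt_moment) (auto simp: mem_half_edges)
    finally show "real (card {B \<in> ?T. h \<in> \<Union>B}) \<le> 2 * sqrt (deg_moment n d 2) * deg_moment n d 2 ^ 2" .
  qed
  also have "\<dots> = 12 * sqrt (deg_moment n d 2) * deg_moment n d 2 ^ 2"
    using card_partial_matching(1)[OF pm(1) finite_half_edges] pm(2) by simp
  finally show ?thesis .
qed

lemma bias_eq_0_if_triangle_free:
  assumes "degree_sequence n d" "M \<in> pairings n d" "avoiding (labelled_triangles n d) M"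
  shows "real n * bias n d M = 0"
proof -
  have "of_bool (triangle u v w \<subseteq> M) = (0 :: real)"
    if "(i, j, k) \<in> distinct_triples {1..n}" "u \<in> wedges d i" "v \<in> wedges d j" "w \<in> wedges d k" for i j k u v w
  proof -
    have "triangle u v w \<in> labelled_triangles n d"
      using that unfolding labelled_triangles_def by blast
    then show ?thesis using assms(3) by simp
  qed
  then show ?thesis
    unfolding bias_eq[OF assms(1) assms(2)[unfolded pairings_eq]]
    by (auto intro!: sum.neutral)
qed

lemma exp_le_one_minus_double:
  fixes p :: real
  assumes "0 \<le> p" "p \<le> 1 / 4"
  shows "exp (- (4 * p)) \<le> 1 - 2 * p"
proof -
  have "- (2 * p) - 2 * (2 * p)\<^sup>2 \<le> ln (1 - 2 * p)"
    using assms by (intro ln_one_minus_pos_lower_bound) auto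
  moreover have "(2 * p)\<^sup>2 \<le> p"
    using mult_left_mono[OF assms(2) assms(1)] by (simp add: power2_eq_square)
  ultimately have "- (4 * p) \<le> ln (1 - 2 * p)" by linarith
  then show ?thesis using assms by (simp add: ln_ge_iff)
qed

text \<open>The local lemma with the labelled triangles as forbidden sets. The exponent is \<open>4\<close> times a bound
  on the expected number of labelled triangles.\<close>

lemma prob_bias_0_ge:
  fixes n :: nat and d :: "nat \<Rightarrow> nat"
  defines "m \<equiv> deg_moment n d"
  assumes d: "degree_sequence n d" and m1: "7 \<le> m 1"
    and dep: "12 * sqrt (m 2) * m 2 ^ 2 / odd_ff 3 (m 1) \<le> 1 / 4"
  shows "exp (- (4 * m 2 ^ 3 / odd_ff 3 (m 1)))
    \<le> measure_pmf.prob (config_model n d) {M. real n * bias n d M = 0}"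
proof -
  let ?H = "half_edges n d" and ?T = "labelled_triangles n d"
  define p where "p = 1 / odd_ff 3 (m 1)"
  have ff: "odd_ff 3 (m 1) = (m 1 - 1) * ((m 1 - 3) * (m 1 - 5))"
    by (simp add: numeral_eq_Suc)
  have "6 * (4 * 2) \<le> (m 1 - 1) * ((m 1 - 3) * (m 1 - 5))"
    using m1 by (intro mult_mono) auto
  then have ff_ge: "4 \<le> odd_ff 3 (m 1)" unfolding ff by simp
  then have p: "0 \<le> p" "p \<le> 1 / 4" by (simp_all add: p_def field_simps)
  have H: "finite ?H" "even (card ?H)"
    using d by (simp_all add: card_half_edges degree_sequence_def)
  have cH: "real (card ?H) = m 1" by (simp add: m_def real_card_half_edges)
  have pF: "1 / odd_ff (card F) (real (card ?H)) = p" if "F \<in> ?T" for F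
    using labelled_triangles_partial_matching(2)[OF that] by (simp add: p_def cH)
  have "(\<Prod>F\<in>?T. 1 - 2 * (1 / odd_ff (card F) (real (card ?H)))) * real (card (perfect_matchings ?H))
      \<le> real (card {M \<in> perfect_matchings ?H. avoiding ?T M})"
  proof (rule local_lemma[OF H(1) finite_labelled_triangles labelled_triangles_partial_matching(1)])
    fix F assume F: "F \<in> ?T"
    have "(\<Sum>B\<in>{B \<in> ?T. conflicting F B}. 1 / odd_ff (card B) (real (card ?H)))
        = real (card {B \<in> ?T. conflicting F B}) * p"
      by (simp add: pF)
    also have "\<dots> \<le> 12 * sqrt (m 2) * m 2 ^ 2 * p"
      unfolding m_def using p(1) by (intro mult_right_mono card_conflicting_triangles_le F)
    also have "\<dots> \<le> 1 / 4" using dep by (simp add: p_def)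
    finally show "(\<Sum>B\<in>{B \<in> ?T. conflicting F B}. 1 / odd_ff (card B) (real (card ?H))) \<le> 1 / 4" .
    show "1 / odd_ff (card F) (real (card ?H)) \<le> 1 / 2" using pF[OF F] p(2) by simp
  qed
  then have LL: "(1 - 2 * p) ^ card ?T * real (card (perfect_matchings ?H))
      \<le> real (card {M \<in> perfect_matchings ?H. avoiding ?T M})"
    by (simp add: pF)
  have "exp (- (4 * m 2 ^ 3 / odd_ff 3 (m 1))) = exp (- (4 * p * m 2 ^ 3))"
    by (simp add: p_def)
  also have "\<dots> \<le> exp (- (4 * p * real (card ?T)))"
    using p(1) card_labelled_triangles_le[of n d] by (simp add: m_def mult_left_mono)
  also have "\<dots> = exp (- (4 * p)) ^ card ?T"
    by (simp add: mult.commute flip: exp_of_nat_mult)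
  also have "\<dots> \<le> (1 - 2 * p) ^ card ?T"
    by (intro power_mono exp_le_one_minus_double p) simp
  also have "\<dots> \<le> real (card {M \<in> perfect_matchings ?H. avoiding ?T M}) / real (card (perfect_matchings ?H))"
    using LL perfect_matchings_nonempty[OF H] finite_perfect_matchings[OF H(1)]
    by (simp add: pos_le_divide_eq card_gt_0_iff)
  also have "\<dots> \<le> real (card {M \<in> perfect_matchings ?H. real n * bias n d M = 0}) / real (card (perfect_matchings ?H))"
    using bias_eq_0_if_triangle_free[OF d, unfolded pairings_eq] finite_perfect_matchings[OF H(1)]
    by (intro divide_right_mono of_nat_mono card_mono) auto
  also have "\<dots> = measure_pmf.prob (config_model n d) {M. real n * bias n d M = 0}"
    unfolding config_model_def pairings_eq by (rule prob_perfect_matchings[OF H, symmetric])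
  finally show ?thesis .
qed

context converging_degrees
begin

text \<open>The mass of the triangles in conflict with a given one is \<open>O (\<surd>n n\<^sup>2 n\<^sup>-\<^sup>3)\<close>, which tends to
  zero, while the exponent in the bound converges to \<open>4 (c 2 / c 1)\<^sup>3\<close>.\<close>

lemma eventually_prob_bias_0_ge:
  "\<exists>\<delta>>0. \<forall>\<^sub>F n in sequentially.
     \<delta> \<le> measure_pmf.prob (config_model n (d n)) {M. real n * bias n (d n) M = 0}"
proof -
  define a where "a k n = deg_moment n (d n) k / real n" for k n
  define u where "u n = 1 / real n" for n :: nat
  define Q where "Q n = (a 1 n - u n) * ((a 1 n - 3 * u n) * (a 1 n - 5 * u n))" for n
  have u: "u \<longlonglongrightarrow> 0" unfolding u_def by (rule lim_1_over_n)
  have a: "a 1 \<longlonglongrightarrow> c 1" "a 2 \<longlonglongrightarrow> c 2" unfolding a_def by (rule moments_numeral)+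
  have Q: "Q \<longlonglongrightarrow> (c 1 - 0) * ((c 1 - 3 * 0) * (c 1 - 5 * 0))"
    unfolding Q_def by (intro tendsto_intros a u)
  have Qne: "(c 1 - 0) * ((c 1 - 3 * 0) * (c 1 - 5 * 0)) \<noteq> 0" using c1_pos by simp
  define L where "L = 4 * c 2 ^ 3 / ((c 1 - 0) * ((c 1 - 3 * 0) * (c 1 - 5 * 0)))"
  have ff: "odd_ff 3 (deg_moment n (d n) 1) = real n ^ 3 * Q n" if n: "1 \<le> n" for n
  proof -
    have "deg_moment n (d n) 1 = real n * a 1 n" "real n * u n = 1" using n by (simp_all add: a_def u_def)
    then show ?thesis by (simp add: numeral_eq_Suc Q_def) algebra
  qed
  have "(\<lambda>n. 12 * sqrt (a 2 n) * a 2 n ^ 2 * sqrt (u n) / Q n)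
      \<longlonglongrightarrow> 12 * sqrt (c 2) * c 2 ^ 2 * sqrt 0 / ((c 1 - 0) * ((c 1 - 3 * 0) * (c 1 - 5 * 0)))"
    by (intro tendsto_intros a u Q Qne)
  then have "(\<lambda>n. 12 * sqrt (a 2 n) * a 2 n ^ 2 * sqrt (u n) / Q n) \<longlonglongrightarrow> 0" by simp
  then have ev1: "\<forall>\<^sub>F n in sequentially. 12 * sqrt (a 2 n) * a 2 n ^ 2 * sqrt (u n) / Q n < 1 / 4"
    by (rule order_tendstoD(2)) simp
  have "(\<lambda>n. 4 * a 2 n ^ 3 / Q n) \<longlonglongrightarrow> L"
    unfolding L_def by (intro tendsto_intros a Q Qne)
  then have ev2: "\<forall>\<^sub>F n in sequentially. 4 * a 2 n ^ 3 / Q n < L + 1"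
    by (rule order_tendstoD(2)) simp
  have "\<forall>\<^sub>F n in sequentially.
     exp (- (L + 1)) \<le> measure_pmf.prob (config_model n (d n)) {M. real n * bias n (d n) M = 0}"
    using ev1 ev2 eventually_ge_at_top[of 7]
  proof eventually_elim
    case (elim n)
    then have n: "1 \<le> n" by simp
    have m2: "deg_moment n (d n) 2 = real n * a 2 n" using n by (simp add: a_def)
    have "12 * sqrt (deg_moment n (d n) 2) * deg_moment n (d n) 2 ^ 2 / odd_ff 3 (deg_moment n (d n) 1)
        = 12 * sqrt (a 2 n) * a 2 n ^ 2 * (sqrt (real n) / real n) / Q n"
      unfolding m2 ff[OF n] using n
      by (simp add: real_sqrt_mult power2_eq_square power3_eq_cube)
    also have "sqrt (real n) / real n = sqrt (u n)"
      using n by (simp add: u_def real_sqrt_divide field_simps)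
    finally have dep: "12 * sqrt (deg_moment n (d n) 2) * deg_moment n (d n) 2 ^ 2
        / odd_ff 3 (deg_moment n (d n) 1) \<le> 1 / 4" using elim by simp
    have "4 * deg_moment n (d n) 2 ^ 3 / odd_ff 3 (deg_moment n (d n) 1) = 4 * a 2 n ^ 3 / Q n"
      unfolding m2 ff[OF n] using n by (simp add: power_mult_distrib)
    then have "exp (- (L + 1)) \<le> exp (- (4 * deg_moment n (d n) 2 ^ 3 / odd_ff 3 (deg_moment n (d n) 1)))"
      using elim by simp
    also have "\<dots> \<le> measure_pmf.prob (config_model n (d n)) {M. real n * bias n (d n) M = 0}"
      using moment_1_ge[of n] elim by (intro prob_bias_0_ge deg_seq n dep) simp
    finally show ?case .
  qed
  then show ?thesis by (intro exI[of _ "exp (- (L + 1))"]) simp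
qed

lemma liminf_prob_bias_0:
  "liminf (\<lambda>n. ereal (measure_pmf.prob (config_model n (d n)) {M. real n * bias n (d n) M = 0})) > 0"
proof -
  obtain \<delta> where \<delta>: "\<delta> > 0" "\<forall>\<^sub>F n in sequentially.
     \<delta> \<le> measure_pmf.prob (config_model n (d n)) {M. real n * bias n (d n) M = 0}"
    using eventually_prob_bias_0_ge by blast
  have "ereal \<delta> \<le> liminf (\<lambda>n. ereal (measure_pmf.prob (config_model n (d n)) {M. real n * bias n (d n) M = 0}))"
    by (rule Liminf_bounded) (use \<delta>(2) in \<open>simp\<close>)
  moreover have "0 < ereal \<delta>" using \<delta>(1) by simp
  ultimately show ?thesis by (rule less_le_trans[rotated])
qed

text \<open>The value \<open>0\<close>, at distance \<open>zeta\<close> from the supposed limit, keeps a positive probability.\<close>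

lemma weak_law_fails:
  assumes "0 < zeta (c 1) (c 2) (c 3)"
  shows "\<not> tendsto_in_prob (\<lambda>n. config_model n (d n)) (\<lambda>n M. real n * bias n (d n) M)
     (zeta (c 1) (c 2) (c 3))"
proof
  let ?z = "zeta (c 1) (c 2) (c 3)"
  assume "tendsto_in_prob (\<lambda>n. config_model n (d n)) (\<lambda>n M. real n * bias n (d n) M) ?z"
  then have lim: "(\<lambda>n. measure_pmf.prob (config_model n (d n)) {M. \<bar>real n * bias n (d n) M - ?z\<bar> > ?z / 2}) \<longlonglongrightarrow> 0"
    using assms unfolding tendsto_in_prob_def by (meson half_gt_zero)
  obtain \<delta> where \<delta>: "\<delta> > 0" "\<forall>\<^sub>F n in sequentially.
     \<delta> \<le> measure_pmf.prob (config_model n (d n)) {M. real n * bias n (d n) M = 0}"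
    using eventually_prob_bias_0_ge by blast
  have "measure_pmf.prob (config_model n (d n)) {M. real n * bias n (d n) M = 0}
      \<le> measure_pmf.prob (config_model n (d n)) {M. \<bar>real n * bias n (d n) M - ?z\<bar> > ?z / 2}" for n
    using assms by (intro measure_pmf.finite_measure_mono) auto
  with \<delta>(2) have "\<forall>\<^sub>F n in sequentially.
     \<delta> \<le> measure_pmf.prob (config_model n (d n)) {M. \<bar>real n * bias n (d n) M - ?z\<bar> > ?z / 2}"
    by (elim eventually_mono order_trans)
  with lim have "\<delta> \<le> 0" by (rule tendsto_lowerbound[OF _ _ sequentially_bot])
  then show False using \<delta>(1) by simp
qed

end

section \<open>The mean, its limit, and the failure of the weak law\<close>

theorem theorem5:
  shows
    "(\<forall>(n::nat) (d::nat \<Rightarrow> nat).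
        degree_sequence n d \<and> deg_moment n d 1 > 7 \<longrightarrow>
        (let m1 = deg_moment n d 1; m2 = deg_moment n d 2; m3 = deg_moment n d 3;
             m4 = deg_moment n d 4; m5 = deg_moment n d 5; m6 = deg_moment n d 6;
             m7 = deg_moment n d 7;
             A1 = 6*m1*m3 - 18*m1*m4 + 14*m1*m5 - 2*m1*m6 + 4*m2*m3 - 8*m2*m4 + 4*m3^2;
             A2 = - 14*m1*m2*m3 + 3*m1*m2*m4 - 9*m1^2*m2 + 18*m1^2*m3 - 5*m1^2*m4
                  + 3*m1*m2^2 + 4*m2^3;
             A3 = - 7*m1^3*m2 - m1*m2^3 + 5*m1^2*m2^2 + 3*m1^4;
             B1 = 2*m7 - 10*m6 + 14*m5 - 6*m4;
             B2 = 6*m1*m3 - 8*m1*m4 + 2*m1*m5 - 13*m2*m3 + 11*m2*m4 - 2*m2*m5 - m3*m4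
                  + 3*m2^2 + 2*m3^2;
             B3 = - 2*m1*m2*m3 - 3*m1^2*m2 + m1^2*m3 + 6*m1*m2^2 + m2^2*m3 - 3*m2^3
         in measure_pmf.expectation (config_model n d) (bias n d)
            = 1 / (2 * (m1 - 1) * (m1 - 3) * (m1 - 5) * (m1 - 7))
              * ((A1 + A2 + A3) / real n + (B1 + B2 + B3))))
     \<and>
     (\<forall>(d::nat \<Rightarrow> nat \<Rightarrow> nat) (c::nat \<Rightarrow> real).
        (\<forall>n\<ge>1. degree_sequence n (d n)) \<and>
        (\<forall>k\<in>{1..7}. (\<lambda>n. deg_moment n (d n) k / real n) \<longlonglongrightarrow> c k \<and> c k > 0) \<longrightarrow>
        ((\<lambda>n. measure_pmf.expectation (config_model n (d n)) (\<lambda>M. real n * bias n (d n) M))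
            \<longlonglongrightarrow> zeta (c 1) (c 2) (c 3)) \<and>
        zeta (c 1) (c 2) (c 3) \<ge> 0 \<and>
        (zeta (c 1) (c 2) (c 3) = 0 \<longleftrightarrow> c 2 = (c 1)^2 \<or> degrees_mostly_le_2 d) \<and>
        (c 2 = (c 1)^2 \<longleftrightarrow> (\<exists>r::nat. \<forall>k\<in>{1..6}. c k = real r ^ k)) \<and>
        (\<forall>r::nat. (\<forall>n\<ge>1. \<forall>i\<in>{1..n}. d n i = r) \<longrightarrow> (\<forall>k\<in>{1..7}. c k = real r ^ k)))
     \<and>
     (\<forall>(d::nat \<Rightarrow> nat \<Rightarrow> nat) (c::nat \<Rightarrow> real).
        (\<forall>n\<ge>1. degree_sequence n (d n)) \<and>
        (\<forall>k\<in>{1..7}. (\<lambda>n. deg_moment n (d n) k / real n) \<longlonglongrightarrow> c k \<and> c k > 0) \<and>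
        c 2 \<noteq> (c 1)^2 \<longrightarrow>
        liminf (\<lambda>n. ereal (measure_pmf.prob (config_model n (d n))
                              {M. real n * bias n (d n) M = 0})) > 0 \<and>
        (\<not> degrees_mostly_le_2 d \<longrightarrow>
           \<not> tendsto_in_prob (\<lambda>n. config_model n (d n)) (\<lambda>n M. real n * bias n (d n) M)
               (zeta (c 1) (c 2) (c 3))))"
proof (intro conjI allI impI, goal_cases)
  case (1 n d)
  then have d: "degree_sequence n d" and m1: "deg_moment n d 1 > 7" by auto
  from m1 have n: "real n \<noteq> 0" by (cases "n = 0") (simp_all add: deg_moment_def)
  have "real n * measure_pmf.expectation (config_model n d) (bias n d)
      = measure_pmf.expectation (config_model n d) (\<lambda>M. real n * bias n d M)" by simp
  note E = this[unfolded expectation_bias_moments[OF d m1]]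
  have divide: "X = 1 / q * ((A1 + A2 + A3) / N + (B1 + B2 + B3))"
    if "N * X = Y / q" "N \<noteq> 0" "Y = (A1 + A2 + A3) + N * (B1 + B2 + B3)"
    for X Y q N A1 A2 A3 B1 B2 B3 :: real
  proof -
    have "X = N * X / N" using that(2) by simp
    also have "\<dots> = Y / N / q" unfolding that(1) by (simp add: mult.commute)
    also have "Y / N = (A1 + A2 + A3) / N + (B1 + B2 + B3)"
      unfolding that(3) using that(2) by (simp add: add_divide_distrib)
    finally show ?thesis by simp
  qed
  show ?case unfolding Let_def by (rule divide[OF E n]) algebra
next
  case (2 d c)
  then interpret converging_degrees d c by unfold_locales auto
  show ?case by (rule expectation_bias_tendsto)
next
  case (3 d c)
  then interpret converging_degrees d c by unfold_locales auto
  show ?case by (rule zeta_nonneg)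
next
  case (4 d c)
  then interpret converging_degrees d c by unfold_locales auto
  show ?case by (rule zeta_eq_0_iff)
next
  case (5 d c)
  then interpret converging_degrees d c by unfold_locales auto
  show ?case by (rule variance_0_iff)
next
  case (6 d c r)
  then interpret converging_degrees d c by unfold_locales auto
  show ?case using regular_moments 6(2) by blast
next
  case (7 d c)
  then interpret converging_degrees d c by unfold_locales auto
  show ?case by (rule liminf_prob_bias_0)
next
  case (8 d c)
  then interpret converging_degrees d c by unfold_locales auto
  have "zeta (c 1) (c 2) (c 3) \<noteq> 0" using zeta_eq_0_iff 8 by blast
  then show ?case using zeta_nonneg by (intro weak_law_fails) simp
qed

end
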